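(* Let $(\mathbb{X},\mathbb{U},\mathcal{T},c)$ be a Markov decision process with $\mathbb{X}\subset\mathbb{R}^n$ Borel and discount factor $\beta\in(0,1)$, such that: (A1) $\mathbb{U}$ is compact (and finite); $c:\mathbb{X}\times\mathbb{U}\to\mathbb{R}$ is nonnegative, bounded and continuous; $\mathcal{T}$ is weak Feller, i.e. $(x,u)\mapsto\int g(x_1)\,\mathcal{T}(dx_1|x,u)$ is continuous for every bounded continuous $g:\mathbb{X}\to\mathbb{R}$; (A2) there are constants $\alpha_c,\alpha_T>0$ such that for all $x,x'\in\mathbb{X}$, $u\in\mathbb{U}$: $|c(x,u)-c(x',u)|\le\alpha_c\|x-x'\|_1$ and $\|\mathcal{T}(\cdot|x,u)-\mathcal{T}(\cdot|x',u)\|_{TV}\le\alpha_T\|x-x'\|_1$. Let $\{B_i\}_{i=1}^M$ be a collection of quantization bins (a measurable partition of $\mathbb{X}$), with weighting measures, finite-model value function $\hat J_\beta$ and loss function $L$ as defined in the context. Then for any initial state $x_0\in\mathbb{X}$, $$\left|\hat J_\beta(x_0)-J^*_\beta(x_0)\right|\le\left(\alpha_c+\frac{\beta\alpha_T\|c\|_\infty}{1-\beta}\right)\frac{1}{1-\beta}\sup_{\gamma_s\in\Gamma_s}\int_{\mathbb{X}}L(x)\,\mu_\beta^{\gamma_s}(dx),$$ where $\Gamma_s$ is the set of stationary policies and $\mu_\beta^{\gamma_s}$ is the normalized discounted occupation measure on the state space under $\gamma_s$ started from $x_0$.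
   Context: MDP: $\mathcal{T}(\cdot|x,u)$ is a stochastic kernel from $\mathbb{X}\times\mathbb{U}$ to $\mathbb{X}$. An admissible policy $\gamma=\{\gamma_t\}$ chooses $U_t=\gamma_t(X_0,\dots,X_t,U_0,\dots,U_{t-1})$ measurably; $\Gamma$ is the set of admissible policies. A stationary policy is given by a measurable $f:\mathbb{X}\to\mathbb{U}$ with $U_t=f(X_t)$ for all $t$. $\mathbb{P}^{\gamma}_{x_0},\mathbb{E}^{\gamma}_{x_0}$ refer to the process started at $X_0=x_0$ under policy $\gamma$ and kernel $\mathcal{T}$. $J_\beta(x_0,\gamma)=\mathbb{E}^\gamma_{x_0}[\sum_{t\ge0}\beta^tc(X_t,U_t)]$ and $J_\beta^*(x_0)=\inf_{\gamma\in\Gamma}J_\beta(x_0,\gamma)$. Finite model: $\pi$ is a probability measure on $\mathbb{X}$ with $\pi(B_i)>0$ for all $i$; each bin $B_i$ has a representative $y_i\in B_i$; $\mathbb{Y}=\{y_1,\dots,y_M\}$; $q(x)=y_i$ for $x\in B_i$. The weighting measures are $\hat\pi_{y_i}(A)=\pi(A)/\pi(B_i)$ for measurable $A\subseteq B_i$. Set $C^*(y_i,u)=\int_{B_i}c(x,u)\,\hat\pi_{y_i}(dx)$ and $P^*(y_j|y_i,u)=\int_{B_i}\mathcal{T}(B_j|x,u)\,\hat\pi_{y_i}(dx)$. $\hat J_\beta:\mathbb{Y}\to\mathbb{R}$ is the solution of $\hat J_\beta(y)=\inf_{u\in\mathbb{U}}\{C^*(y,u)+\beta\sum_{z\in\mathbb{Y}}\hat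 J_\beta(z)P^*(z|y,u)\}$, extended to $\mathbb{X}$ by $\hat J_\beta(x)=\hat J_\beta(q(x))$. Loss function: $L(x)=\int_{B_i}\|x-x'\|_1\,\hat\pi_{y_i}(dx')$ for $x\in B_i$ (values in $[0,\infty]$), with $\|\cdot\|_1$ the $\ell_1$ norm on $\mathbb{R}^n$. Occupation measure: $\mu_\beta^{\gamma_s}(A)=(1-\beta)\sum_{t=0}^\infty\beta^t\,\mathbb{P}^{\gamma_s}_{x_0}(X_t\in A)$ for Borel $A\subseteq\mathbb{X}$ (a probability measure depending on $x_0$). Total variation convention: $\|\mu-\nu\|_{TV}=\sup_{\|f\|_\infty\le1}|\int f\,d\mu-\int f\,d\nu|$. The right-hand side may be $+\infty$. *)

theory Defs
  imports "HOL-Probability.Probability"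
begin

definition l1_norm :: "real ^ 'n \<Rightarrow> real" where
  "l1_norm x = (\<Sum>i\<in>UNIV. \<bar>x $ i\<bar>)"

abbreviation borel_on :: "'a::topological_space set \<Rightarrow> 'a measure" where
  "borel_on S \<equiv> restrict_space borel S"

text \<open>The test functions are only constrained on the space of \<open>\<mu>\<close>. On probability measures
  over the same space the supremum is over a nonempty set bounded by 2, hence it is a genuine real
  supremum. In this normalization the distance is twice the one defined by suprema over events.\<close>

definition tv_dist :: "'a measure \<Rightarrow> 'a measure \<Rightarrow> real" where
  "tv_dist \<mu> \<nu> =
    (SUP f\<in>{f \<in> borel_measurable \<mu>. \<forall>x\<in>space \<mu>. \<bar>f x\<bar> \<le> (1::real)}. \<bar>(LINT x|\<mu>. f x) - (LINT x|\<nu>. f x)\<bar>)"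

definition weak_feller ::
  "'a::topological_space set \<Rightarrow> 'u::topological_space set \<Rightarrow> ('a \<Rightarrow> 'u \<Rightarrow> 'a measure) \<Rightarrow> bool" where
  "weak_feller X U T \<longleftrightarrow>
    (\<forall>g :: 'a \<Rightarrow> real. continuous_on X g \<longrightarrow> bounded (g ` X) \<longrightarrow>
       continuous_on (X \<times> U) (\<lambda>(x, u). LINT x1|T x u. g x1))"

definition cost_sup_norm :: "'a set \<Rightarrow> 'u set \<Rightarrow> ('a \<Rightarrow> 'u \<Rightarrow> real) \<Rightarrow> real" where
  "cost_sup_norm X U c = (SUP (x, u)\<in>X \<times> U. \<bar>c x u\<bar>)"


section \<open>Policies and the controlled process\<close>

text \<open>A decision rule at time \<open>t\<close> receives the states up to time \<open>t\<close> and the actions before time \<open>t\<close>.\<close>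

type_synonym ('a, 'u) policy = "nat \<Rightarrow> (nat \<Rightarrow> 'a) \<times> (nat \<Rightarrow> 'u) \<Rightarrow> 'u"

definition admissible_policies ::
  "'a::topological_space set \<Rightarrow> 'u::topological_space set \<Rightarrow> ('a, 'u) policy set" where
  "admissible_policies X U =
    {\<gamma>. \<forall>t. \<gamma> t \<in> (PiM {..t} (\<lambda>_. borel_on X) \<Otimes>\<^sub>M PiM {..<t} (\<lambda>_. borel_on U)) \<rightarrow>\<^sub>M borel_on U}"

definition stationary_policies ::
  "'a::topological_space set \<Rightarrow> 'u::topological_space set \<Rightarrow> ('a, 'u) policy set" where
  "stationary_policies X U = {(\<lambda>t (xs, us). f (xs t)) | f. f \<in> borel_on X \<rightarrow>\<^sub>M borel_on U}"

lemma stationary_admissible: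
  "stationary_policies X U \<subseteq> admissible_policies X U"
proof -
  have "(\<lambda>(xs, us). f (xs t)) \<in> (PiM {..t} (\<lambda>_. borel_on X) \<Otimes>\<^sub>M PiM {..<t} (\<lambda>_. borel_on U)) \<rightarrow>\<^sub>M borel_on U"
    if [measurable]: "f \<in> borel_on X \<rightarrow>\<^sub>M borel_on U" for f and t :: nat
  proof -
    have [measurable]: "(\<lambda>xs. xs t) \<in> PiM {..t} (\<lambda>_. borel_on X) \<rightarrow>\<^sub>M borel_on X"
      by (rule measurable_component_singleton) simp
    show ?thesis by measurable
  qed
  then show ?thesis by (auto simp: stationary_policies_def admissible_policies_def)
qed

text \<open>Conditional law of the pair \<open>(X\<^sub>t, U\<^sub>t)\<close> given the earlier pairs \<open>\<omega> 0, \<dots>, \<omega> (t - 1)\<close>: the state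
  \<open>X\<^sub>t\<close> is \<open>x0\<close> for \<open>t = 0\<close> and is drawn from \<open>T\<close> afterwards, and \<open>U\<^sub>t\<close> is then chosen by the policy.\<close>

definition step_law ::
  "'a::topological_space set \<Rightarrow> 'u::topological_space set \<Rightarrow> ('a \<Rightarrow> 'u \<Rightarrow> 'a measure) \<Rightarrow> 'a \<Rightarrow>
   ('a, 'u) policy \<Rightarrow> nat \<Rightarrow> (nat \<Rightarrow> 'a \<times> 'u) \<Rightarrow> ('a \<times> 'u) measure" where
  "step_law X U T x0 \<gamma> t \<omega> =
    distr (if t = 0 then return (borel_on X) x0 else T (fst (\<omega> (t - 1))) (snd (\<omega> (t - 1))))
      (borel_on X \<Otimes>\<^sub>M borel_on U)
      (\<lambda>x. (x, \<gamma> t (\<lambda>s\<in>{..t}. if s < t then fst (\<omega> s) else x, \<lambda>s\<in>{..<t}. snd (\<omega> s))))"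

text \<open>The law of the whole trajectory is the Ionescu-Tulcea extension of the conditional laws.\<close>

definition trajectory_law ::
  "'a::topological_space set \<Rightarrow> 'u::topological_space set \<Rightarrow> ('a \<Rightarrow> 'u \<Rightarrow> 'a measure) \<Rightarrow> 'a \<Rightarrow>
   ('a, 'u) policy \<Rightarrow> (nat \<Rightarrow> 'a \<times> 'u) measure" where
  "trajectory_law X U T x0 \<gamma> =
    projective_family.lim UNIV
      (Ionescu_Tulcea.CI (step_law X U T x0 \<gamma>) (\<lambda>_. borel_on X \<Otimes>\<^sub>M borel_on U))
      (\<lambda>_. borel_on X \<Otimes>\<^sub>M borel_on U)"

lemma Ionescu_Tulcea_step_law:
  assumes T: "(\<lambda>(x, u). T x u) \<in> (borel_on X \<Otimes>\<^sub>M borel_on U) \<rightarrow>\<^sub>M prob_algebra (borel_on X)"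
    and \<gamma>: "\<gamma> \<in> admissible_policies X U" and x0: "x0 \<in> X"
  shows "Ionescu_Tulcea (step_law X U T x0 \<gamma>) (\<lambda>_. borel_on X \<Otimes>\<^sub>M borel_on U)"
proof -
  let ?S = "borel_on X \<Otimes>\<^sub>M borel_on U"
  have K: "step_law X U T x0 \<gamma> t \<in> PiM {0..<t} (\<lambda>_. ?S) \<rightarrow>\<^sub>M prob_algebra ?S" for t
  proof -
    let ?H = "PiM {0..<t} (\<lambda>_. ?S)"
    have g[measurable]: "\<gamma> t \<in> (PiM {..t} (\<lambda>_. borel_on X) \<Otimes>\<^sub>M PiM {..<t} (\<lambda>_. borel_on U)) \<rightarrow>\<^sub>M borel_on U"
      using \<gamma> by (auto simp: admissible_policies_def)
    have comp: "(\<lambda>\<omega>. \<omega> s) \<in> ?H \<rightarrow>\<^sub>M ?S" if "s < t" for s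
      by (rule measurable_component_singleton) (use that in auto)
    have h1: "(\<lambda>(\<omega>, x). \<lambda>s\<in>{..t}. if s < t then fst (\<omega> s) else x) \<in> ?H \<Otimes>\<^sub>M borel_on X \<rightarrow>\<^sub>M PiM {..t} (\<lambda>_. borel_on X)"
      unfolding case_prod_beta
    proof (rule measurable_restrict)
      fix s assume "s \<in> {..t}"
      show "(\<lambda>p. if s < t then fst (fst p s) else snd p) \<in> ?H \<Otimes>\<^sub>M borel_on X \<rightarrow>\<^sub>M borel_on X"
      proof (cases "s < t")
        case True
        note [measurable] = comp[OF True]
        show ?thesis using True by simp
      qed simp
    qed
    have h2: "(\<lambda>(\<omega>, x). \<lambda>s\<in>{..<t}. snd (\<omega> s)) \<in> ?H \<Otimes>\<^sub>M borel_on X \<rightarrow>\<^sub>M PiM {..<t} (\<lambda>_. borel_on U)"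
      unfolding case_prod_beta
    proof (rule measurable_restrict)
      fix s assume "s \<in> {..<t}"
      then have [measurable]: "(\<lambda>\<omega>. \<omega> s) \<in> ?H \<rightarrow>\<^sub>M ?S" by (auto intro: comp)
      show "(\<lambda>p. snd (fst p s)) \<in> ?H \<Otimes>\<^sub>M borel_on X \<rightarrow>\<^sub>M borel_on U" by measurable
    qed
    note [measurable] = h1 h2
    have f: "(\<lambda>(\<omega>, x). (x, \<gamma> t (\<lambda>s\<in>{..t}. if s < t then fst (\<omega> s) else x, \<lambda>s\<in>{..<t}. snd (\<omega> s))))
        \<in> ?H \<Otimes>\<^sub>M borel_on X \<rightarrow>\<^sub>M ?S"
      using h1 h2 g unfolding case_prod_beta by measurable
    have n: "(\<lambda>\<omega>. if t = 0 then return (borel_on X) x0 else T (fst (\<omega> (t - 1))) (snd (\<omega> (t - 1))))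
        \<in> ?H \<rightarrow>\<^sub>M prob_algebra (borel_on X)"
    proof (cases "t = 0")
      case True
      then show ?thesis using x0
        by (auto intro!: measurable_const simp: space_prob_algebra prob_space_return space_restrict_space)
    next
      case False
      then have "(\<lambda>\<omega>. \<omega> (t - 1)) \<in> ?H \<rightarrow>\<^sub>M ?S" by (intro comp) auto
      from measurable_compose[OF this T] False show ?thesis by (simp add: case_prod_beta)
    qed
    show ?thesis
      unfolding step_law_def[abs_def]
      by (rule measurable_distr_prob_space2[OF n f])
  qed
  show ?thesis
  proof (rule Ionescu_Tulcea.intro)
    show "step_law X U T x0 \<gamma> i \<in> PiM {0..<i} (\<lambda>_. ?S) \<rightarrow>\<^sub>M subprob_algebra ?S" for i
      using K by (rule measurable_prob_algebraD)
    fix i :: nat and x assume "x \<in> space (PiM {0..<i} (\<lambda>_. ?S))"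
    then show "prob_space (step_law X U T x0 \<gamma> i x)"
      using measurable_space[OF K] by (auto simp: space_prob_algebra)
  qed
qed

lemma trajectory_law_well_formed:
  assumes "Ionescu_Tulcea (step_law X U T x0 \<gamma>) (\<lambda>_. borel_on X \<Otimes>\<^sub>M borel_on U)"
  shows "prob_space (trajectory_law X U T x0 \<gamma>)"
    "sets (trajectory_law X U T x0 \<gamma>) = sets (PiM UNIV (\<lambda>_. borel_on X \<Otimes>\<^sub>M borel_on U))"
proof -
  interpret Ionescu_Tulcea "step_law X U T x0 \<gamma>" "\<lambda>_. borel_on X \<Otimes>\<^sub>M borel_on U" by fact
  show "sets (trajectory_law X U T x0 \<gamma>) = sets (PiM UNIV (\<lambda>_. borel_on X \<Otimes>\<^sub>M borel_on U))"
    unfolding trajectory_law_def by simp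
  have "emeasure PF.lim (PF.emb UNIV {} {\<lambda>_. undefined}) = emeasure (CI {}) {\<lambda>_. undefined}"
    by (rule lim) (auto simp: PiM_empty)
  moreover have "prob_space (CI {})" by (rule PF.prob_space_P) auto
  then have "emeasure (CI {}) {\<lambda>_. undefined} = 1"
    using prob_space.emeasure_space_1[of "CI {}"] by (simp add: CI_def PiM_empty)
  ultimately show "prob_space (trajectory_law X U T x0 \<gamma>)"
    unfolding trajectory_law_def by (intro prob_spaceI) (auto simp: prod_emb_def space_PiM restrict_def vimage_def PiE_def)
qed
definition discounted_cost ::
  "'a::topological_space set \<Rightarrow> 'u::topological_space set \<Rightarrow> ('a \<Rightarrow> 'u \<Rightarrow> 'a measure) \<Rightarrow>
   ('a \<Rightarrow> 'u \<Rightarrow> real) \<Rightarrow> real \<Rightarrow> 'a \<Rightarrow> ('a, 'u) policy \<Rightarrow> real" where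
  "discounted_cost X U T c \<beta> x0 \<gamma> =
    (LINT \<omega>|trajectory_law X U T x0 \<gamma>. (\<Sum>t. \<beta> ^ t * c (fst (\<omega> t)) (snd (\<omega> t))))"

definition optimal_cost ::
  "'a::topological_space set \<Rightarrow> 'u::topological_space set \<Rightarrow> ('a \<Rightarrow> 'u \<Rightarrow> 'a measure) \<Rightarrow>
   ('a \<Rightarrow> 'u \<Rightarrow> real) \<Rightarrow> real \<Rightarrow> 'a \<Rightarrow> real" where
  "optimal_cost X U T c \<beta> x0 = (INF \<gamma>\<in>admissible_policies X U. discounted_cost X U T c \<beta> x0 \<gamma>)"

definition occupation_measure ::
  "'a::topological_space set \<Rightarrow> 'u::topological_space set \<Rightarrow> ('a \<Rightarrow> 'u \<Rightarrow> 'a measure) \<Rightarrow>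
   real \<Rightarrow> 'a \<Rightarrow> ('a, 'u) policy \<Rightarrow> 'a measure" where
  "occupation_measure X U T \<beta> x0 \<gamma> =
    measure_of X (sets (borel_on X))
      (\<lambda>A. ennreal (1 - \<beta>) *
        (\<Sum>t. ennreal (\<beta> ^ t) *
          emeasure (trajectory_law X U T x0 \<gamma>)
            {\<omega> \<in> space (trajectory_law X U T x0 \<gamma>). fst (\<omega> t) \<in> A}))"


section \<open>The quantized finite model\<close>

text \<open>The bins are \<open>B 1, \<dots>, B M\<close> with representatives \<open>y 1, \<dots>, y M\<close>. As \<open>y i \<in> B i\<close> and the bins are
  disjoint, a finite state \<open>y i\<close> determines its bin, so the data of the finite model are indexed by
  points instead of indices.\<close>

definition bin_index :: "(nat \<Rightarrow> 'a set) \<Rightarrow> nat \<Rightarrow> 'a \<Rightarrow> nat" where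
  "bin_index B M x = (THE i. i \<in> {1..M} \<and> x \<in> B i)"

definition bin :: "(nat \<Rightarrow> 'a set) \<Rightarrow> nat \<Rightarrow> 'a \<Rightarrow> 'a set" where
  "bin B M x = B (bin_index B M x)"

definition quantizer :: "(nat \<Rightarrow> 'a set) \<Rightarrow> nat \<Rightarrow> (nat \<Rightarrow> 'a) \<Rightarrow> 'a \<Rightarrow> 'a" where
  "quantizer B M y x = y (bin_index B M x)"

definition finite_states :: "nat \<Rightarrow> (nat \<Rightarrow> 'a) \<Rightarrow> 'a set" where
  "finite_states M y = y ` {1..M}"

text \<open>The weighting measure of a bin is realized as a measure on the whole state space that is
  concentrated on the bin.\<close>

definition weighting :: "(nat \<Rightarrow> 'a set) \<Rightarrow> nat \<Rightarrow> 'a measure \<Rightarrow> 'a \<Rightarrow> 'a measure" where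
  "weighting B M \<pi> v = uniform_measure \<pi> (bin B M v)"

definition finite_cost ::
  "(nat \<Rightarrow> 'a set) \<Rightarrow> nat \<Rightarrow> 'a measure \<Rightarrow> ('a \<Rightarrow> 'u \<Rightarrow> real) \<Rightarrow> 'a \<Rightarrow> 'u \<Rightarrow> real" where
  "finite_cost B M \<pi> c v u = (LINT x:bin B M v|weighting B M \<pi> v. c x u)"

definition finite_kernel ::
  "(nat \<Rightarrow> 'a set) \<Rightarrow> nat \<Rightarrow> 'a measure \<Rightarrow> ('a \<Rightarrow> 'u \<Rightarrow> 'a measure) \<Rightarrow> 'a \<Rightarrow> 'a \<Rightarrow> 'u \<Rightarrow> real" where
  "finite_kernel B M \<pi> T z v u = (LINT x:bin B M v|weighting B M \<pi> v. measure (T x u) (bin B M z))"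

text \<open>Restriction to extensional functions makes the solution on the finite state set unique as a
  total function.\<close>

definition finite_value ::
  "'u set \<Rightarrow> ('a \<Rightarrow> 'u \<Rightarrow> 'a measure) \<Rightarrow> ('a \<Rightarrow> 'u \<Rightarrow> real) \<Rightarrow> real \<Rightarrow>
   (nat \<Rightarrow> 'a set) \<Rightarrow> nat \<Rightarrow> (nat \<Rightarrow> 'a) \<Rightarrow> 'a measure \<Rightarrow> 'a \<Rightarrow> real" where
  "finite_value U T c \<beta> B M y \<pi> =
    (THE J. J \<in> extensional (finite_states M y) \<and>
      (\<forall>v\<in>finite_states M y.
        J v = (INF u\<in>U. finite_cost B M \<pi> c v u
                 + \<beta> * (\<Sum>z\<in>finite_states M y. J z * finite_kernel B M \<pi> T z v u))))"

definition approx_value ::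
  "'u set \<Rightarrow> ('a \<Rightarrow> 'u \<Rightarrow> 'a measure) \<Rightarrow> ('a \<Rightarrow> 'u \<Rightarrow> real) \<Rightarrow> real \<Rightarrow>
   (nat \<Rightarrow> 'a set) \<Rightarrow> nat \<Rightarrow> (nat \<Rightarrow> 'a) \<Rightarrow> 'a measure \<Rightarrow> 'a \<Rightarrow> real" where
  "approx_value U T c \<beta> B M y \<pi> x = finite_value U T c \<beta> B M y \<pi> (quantizer B M y x)"

definition quantization_loss ::
  "(nat \<Rightarrow> (real ^ 'n) set) \<Rightarrow> nat \<Rightarrow> (real ^ 'n) measure \<Rightarrow> real ^ 'n \<Rightarrow> ennreal" where
  "quantization_loss B M \<pi> x = (\<integral>\<^sup>+x'\<in>bin B M x. ennreal (l1_norm (x - x')) \<partial>weighting B M \<pi> x)"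

end

theory Submission
  imports Defs
begin

text \<open>Let \<open>J\<close> be the finite-model value, extended to \<open>X\<close>, and compare the one-step action value
  \<open>Q x u = c x u + \<beta> * (\<integral>J dT x u)\<close> with its average \<open>Q' x u\<close> over the bin of \<open>x\<close>. The finite Bellman
  equation says \<open>J x = min\<^sub>u Q' x u\<close>, and since \<open>0 \<le> J \<le> \<parallel>c\<parallel> / (1 - \<beta>)\<close> the Lipschitz assumptions give
  \<open>\<bar>Q' x u - Q x u\<bar> \<le> K * L x\<close> with \<open>K\<close> the constant in parentheses in the bound. Hence \<open>J\<close> satisfies a perturbed
  Bellman inequality along every stationary policy. Iterated along an optimal stationary policy it
  bounds \<open>J\<close> by the optimal cost plus the discounted loss; iterated along a minimizer of \<open>Q'\<close> it
  bounds the cost of that policy, hence the optimal cost, by \<open>J\<close> plus the discounted loss. Each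
  discounted loss is \<open>1 / (1 - \<beta>)\<close> times an integral against an occupation measure. All iterations
  take place in \<open>ennreal\<close>, so that an infinite loss needs no special treatment.\<close>

section \<open>Trajectory laws and discounted sums\<close>

text \<open>The limit measure is known only through its finite-dimensional marginals
  \<open>CI J\<close>; for an initial segment \<open>J\<close> that marginal is exactly the
  \<open>n\<close>-fold composition of kernels \<open>C 0 n\<close>.\<close>

lemma (in Ionescu_Tulcea) nn_integral_lim_restrict:
  assumes f[measurable]: "f \<in> borel_measurable (PiM {0..<n} M)"
  shows "(\<integral>\<^sup>+\<omega>. f (restrict \<omega> {0..<n}) \<partial>PF.lim) = (\<integral>\<^sup>+\<omega>. f \<omega> \<partial>C 0 n (\<lambda>_. undefined))"
proof -
  \<comment> \<open>\<open>CI J\<close> runs \<open>up_to J\<close> steps and then restricts to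
    \<open>J\<close>; with this equation the restriction cuts nothing off.\<close>
  have "up_to {0..<n} = n"
  proof (rule antisym)
    show "up_to {0..<n} \<le> n" by (simp add: up_to_iff_Ico)
    show "n \<le> up_to {0..<n}" using up_to[of "{0..<n}"] by (cases n) auto
  qed
  then have "CI {0..<n} = C 0 n (\<lambda>_. undefined)"
    unfolding CI_def using distr_C[of n n "\<lambda>_. undefined" 0] by simp
  then have d: "distr PF.lim (PiM {0..<n} M) (\<lambda>x. restrict x {0..<n}) = C 0 n (\<lambda>_. undefined)"
    using distr_lim[of "{0..<n}"] by simp
  have "(\<lambda>x. restrict x {0..<n}) \<in> PF.lim \<rightarrow>\<^sub>M PiM {0..<n} M"
    by (auto simp: measurable_cong_sets[OF PF.sets_lim refl] intro!: measurable_restrict)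
  from nn_integral_distr[OF this, of f] show ?thesis
    unfolding d[symmetric] by simp
qed

text \<open>Disintegration at time \<open>n\<close>: \<open>C 0 (Suc n)\<close> is
  \<open>C 0 n\<close> followed by \<open>eP n\<close>, which appends to a history a coordinate
  drawn from \<open>P n\<close>. This is the only access to the trajectory law used below.\<close>

lemma (in Ionescu_Tulcea) nn_integral_lim_component:
  assumes k[measurable]: "k \<in> borel_measurable (M n)"
  shows "(\<integral>\<^sup>+\<omega>. k (\<omega> n) \<partial>PF.lim) = (\<integral>\<^sup>+\<omega>. (\<integral>\<^sup>+x. k x \<partial>P n (restrict \<omega> {0..<n})) \<partial>PF.lim)"
proof -
  have u[simp]: "(\<lambda>_. undefined) \<in> space (PiM {0..<0} M)" by (simp add: space_PiM)
  have k': "(\<lambda>\<omega>. k (\<omega> n)) \<in> borel_measurable (PiM {0..<Suc n} M)" by measurable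
  have "(\<integral>\<^sup>+\<omega>. k (\<omega> n) \<partial>PF.lim) = (\<integral>\<^sup>+\<omega>. k (\<omega> n) \<partial>C 0 (Suc n) (\<lambda>_. undefined))"
    using nn_integral_lim_restrict[OF k'] by simp
  also have "\<dots> = (\<integral>\<^sup>+\<omega>. (\<integral>\<^sup>+x. k (x n) \<partial>eP n \<omega>) \<partial>C 0 n (\<lambda>_. undefined))"
    using measurable_C[of 0 n] k'
    by (simp add: nn_integral_bind[OF k'] measurable_cong_sets[OF sets_C refl])
  also have "\<dots> = (\<integral>\<^sup>+\<omega>. (\<integral>\<^sup>+x. k x \<partial>P n \<omega>) \<partial>C 0 n (\<lambda>_. undefined))"
  proof (rule nn_integral_cong)
    fix \<omega> assume "\<omega> \<in> space (C 0 n (\<lambda>_. undefined))"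
    then have "\<omega> \<in> space (PiM {0..<n} M)" using space_C[OF u, of n] by simp
    then show "(\<integral>\<^sup>+x. k (x n) \<partial>eP n \<omega>) = (\<integral>\<^sup>+x. k x \<partial>P n \<omega>)"
      by (simp add: nn_integral_eP[OF _ k'])
  qed
  also have "\<dots> = (\<integral>\<^sup>+\<omega>. (\<integral>\<^sup>+x. k x \<partial>P n (restrict \<omega> {0..<n})) \<partial>PF.lim)"
    by (rule nn_integral_lim_restrict[symmetric]) measurable
  finally show ?thesis .
qed

text \<open>Weighting the \<open>t\<close>-th inequality with \<open>b ^ t\<close> makes the terms
  in \<open>a\<close> telescope; the remainder \<open>b ^ n * a n\<close> stands on the smaller side
  and is dropped.\<close>

lemma discounted_sum_le:
  fixes b :: ennreal
  assumes "\<And>t. k t + b * a (Suc t) \<le> a t + l t"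
  shows "(\<Sum>t. b ^ t * k t) \<le> a 0 + (\<Sum>t. b ^ t * l t)"
proof -
  have *: "(\<Sum>t<n. b ^ t * k t) + b ^ n * a n \<le> a 0 + (\<Sum>t<n. b ^ t * l t)" for n
  proof (induction n)
    case (Suc n)
    have "(\<Sum>t<Suc n. b ^ t * k t) + b ^ Suc n * a (Suc n)
        = (\<Sum>t<n. b ^ t * k t) + b ^ n * (k n + b * a (Suc n))"
      by (simp add: algebra_simps)
    also have "\<dots> \<le> (\<Sum>t<n. b ^ t * k t) + b ^ n * (a n + l n)"
      by (intro add_mono mult_left_mono assms) auto
    also have "\<dots> = ((\<Sum>t<n. b ^ t * k t) + b ^ n * a n) + b ^ n * l n"
      by (simp add: algebra_simps)
    also have "\<dots> \<le> (a 0 + (\<Sum>t<n. b ^ t * l t)) + b ^ n * l n"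
      by (intro add_mono Suc.IH) auto
    finally show ?case by (simp add: algebra_simps)
  qed simp
  have "(\<Sum>t<n. b ^ t * k t) \<le> a 0 + (\<Sum>t. b ^ t * l t)" for n
    by (rule order_trans[OF _ order_trans[OF *[of n]]])
      (auto intro!: add_left_mono sum_le_suminf)
  then show ?thesis
    by (auto simp: suminf_eq_SUP intro: SUP_least)
qed

text \<open>The reverse telescoping leaves the remainder on the larger side, so it has to vanish:
  this is where the uniform bound \<open>D\<close> and \<open>\<beta> < 1\<close> enter.\<close>

lemma le_discounted_sum:
  fixes \<beta> D :: real
  assumes "0 \<le> \<beta>" "\<beta> < 1" and step: "\<And>t. a t \<le> k t + ennreal \<beta> * a (Suc t)"
    and bound: "\<And>t. a t \<le> ennreal D"
  shows "a 0 \<le> (\<Sum>t. ennreal \<beta> ^ t * k t)"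
proof -
  have *: "a 0 \<le> (\<Sum>t<n. ennreal \<beta> ^ t * k t) + ennreal \<beta> ^ n * a n" for n
  proof (induction n)
    case (Suc n)
    note Suc.IH
    also have "(\<Sum>t<n. ennreal \<beta> ^ t * k t) + ennreal \<beta> ^ n * a n
      \<le> (\<Sum>t<n. ennreal \<beta> ^ t * k t) + ennreal \<beta> ^ n * (k n + ennreal \<beta> * a (Suc n))"
      by (intro add_mono mult_left_mono step) auto
    finally show ?case by (simp add: algebra_simps)
  qed simp
  have "a 0 \<le> (\<Sum>t. ennreal \<beta> ^ t * k t) + ennreal (\<beta> ^ n * D)" for n
    using assms(1)
    by (intro order_trans[OF *[of n]] add_mono sum_le_suminf)
      (auto simp: ennreal_mult' ennreal_power intro!: mult_left_mono bound)
  moreover have "(\<lambda>n. (\<Sum>t. ennreal \<beta> ^ t * k t) + ennreal (\<beta> ^ n * D)) \<longlonglongrightarrow> (\<Sum>t. ennreal \<beta> ^ t * k t) + ennreal (0 * D)"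
    using assms(1,2) by (intro tendsto_intros tendsto_ennrealI LIMSEQ_realpow_zero) auto
  ultimately show ?thesis
    by (auto intro: LIMSEQ_le_const)
qed

section \<open>Finite minima and measurable selection\<close>

lemma tendsto_INF_finite:
  fixes f :: "'i \<Rightarrow> 'b \<Rightarrow> 'c::{conditionally_complete_linorder, linorder_topology}"
  assumes "finite I" "I \<noteq> {}" "\<And>i. i \<in> I \<Longrightarrow> (f i \<longlongrightarrow> l i) F"
  shows "((\<lambda>x. INF i\<in>I. f i x) \<longlongrightarrow> (INF i\<in>I. l i)) F"
  using assms
proof (induction I rule: finite_ne_induct)
  case (insert i I)
  then have "((\<lambda>x. min (f i x) (INF i\<in>I. f i x)) \<longlongrightarrow> min (l i) (INF i\<in>I. l i)) F"
    by (intro tendsto_min) auto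
  with insert.hyps show ?case
    by (simp add: cInf_insert inf_min)
qed simp

text \<open>A new index is compared with the running minimum and taken where it is no larger. The
  induction therefore has to carry the measurability of the minimum along with the selector.\<close>

lemma measurable_argmin_finite:
  fixes Q :: "'i \<Rightarrow> 'a \<Rightarrow> 'c::{conditionally_complete_linorder, linorder_topology, second_countable_topology}"
  assumes "finite I" "I \<noteq> {}" "I \<subseteq> space N" and "\<And>i. i \<in> I \<Longrightarrow> Q i \<in> borel_measurable M"
  obtains f where "f \<in> M \<rightarrow>\<^sub>M N" "\<And>x. f x \<in> I" "\<And>x. Q (f x) x = (INF i\<in>I. Q i x)"
proof -
  have "\<exists>f. f \<in> M \<rightarrow>\<^sub>M N \<and> (\<forall>x. f x \<in> I \<and> Q (f x) x = (INF i\<in>I. Q i x)) \<and>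
      (\<lambda>x. INF i\<in>I. Q i x) \<in> borel_measurable M"
    using assms
  proof (induction I rule: finite_ne_induct)
    case (singleton i)
    then show ?case by (intro exI[of _ "\<lambda>_. i"]) auto
  next
    case (insert i I)
    have "I \<subseteq> space N" "\<And>i. i \<in> I \<Longrightarrow> Q i \<in> borel_measurable M" using insert.prems by auto
    from insert.IH[OF this] obtain f where [measurable]:
        "f \<in> M \<rightarrow>\<^sub>M N" "(\<lambda>x. INF i\<in>I. Q i x) \<in> borel_measurable M"
      and f: "\<And>x. f x \<in> I" "\<And>x. Q (f x) x = (INF i\<in>I. Q i x)" by blast
    have [measurable]: "Q i \<in> borel_measurable M" "i \<in> space N" using insert.prems by auto
    have eq: "(INF i\<in>insert i I. Q i x) = min (Q i x) (INF i\<in>I. Q i x)" for x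
      using insert.hyps by (simp add: cInf_insert inf_min)
    let ?g = "\<lambda>x. if Q i x \<le> (INF i\<in>I. Q i x) then i else f x"
    have "?g \<in> M \<rightarrow>\<^sub>M N" by measurable
    moreover have "?g x \<in> insert i I \<and> Q (?g x) x = (INF i\<in>insert i I. Q i x)" for x
      unfolding eq using f[of x] by (simp add: min_def)
    moreover have "(\<lambda>x. INF i\<in>insert i I. Q i x) \<in> borel_measurable M"
      unfolding eq by measurable
    ultimately show ?case by (intro exI[of _ ?g] conjI allI) simp_all
  qed
  then show thesis using that by blast
qed

section \<open>Bounded expectations and total variation\<close>

lemma (in prob_space) integrable_abs_le:
  fixes f :: "'a \<Rightarrow> real"
  assumes "f \<in> borel_measurable M" "\<And>x. x \<in> space M \<Longrightarrow> \<bar>f x\<bar> \<le> D"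
  shows "integrable M f"
  using assms by (intro integrable_const_bound[of f D] AE_I2) auto

lemma (in prob_space) abs_expectation_le:
  fixes f :: "'a \<Rightarrow> real"
  assumes f: "f \<in> borel_measurable M" and D: "\<And>x. x \<in> space M \<Longrightarrow> \<bar>f x\<bar> \<le> D"
  shows "\<bar>expectation f\<bar> \<le> D"
proof -
  note int = integrable_abs_le[OF f D]
  have "expectation f \<le> D" "- D \<le> expectation f"
    using D by (auto intro!: integral_le_const integral_ge_const int AE_I2 simp: abs_le_iff minus_le_iff)
  then show ?thesis by linarith
qed

text \<open>Scaled by \<open>1 / D\<close>, the function \<open>f\<close> becomes an admissible test
  function. The supremum in \<open>tv_dist\<close> is a real one, so an upper bound for the set must
  be supplied; 2 serves.\<close>

lemma abs_integral_diff_le_tv_dist: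
  fixes f :: "'a \<Rightarrow> real"
  assumes "prob_space \<mu>" "prob_space \<nu>" and sets: "sets \<nu> = sets \<mu>"
    and f[measurable]: "f \<in> borel_measurable \<mu>" and bound: "\<And>x. x \<in> space \<mu> \<Longrightarrow> \<bar>f x\<bar> \<le> D"
  shows "\<bar>(LINT x|\<mu>. f x) - (LINT x|\<nu>. f x)\<bar> \<le> D * tv_dist \<mu> \<nu>"
proof -
  interpret \<mu>: prob_space \<mu> by fact
  interpret \<nu>: prob_space \<nu> by fact
  have space: "space \<nu> = space \<mu>" using sets by (rule sets_eq_imp_space_eq)
  have int_le: "\<bar>LINT x|\<mu>. g x\<bar> \<le> E" "\<bar>LINT x|\<nu>. g x\<bar> \<le> E"
    if [measurable]: "g \<in> borel_measurable \<mu>" and g: "\<And>x. x \<in> space \<mu> \<Longrightarrow> \<bar>g x\<bar> \<le> E" for g :: "'a \<Rightarrow> real" and E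
  proof -
    have m: "g \<in> borel_measurable \<nu>" using that(1) by (simp add: measurable_cong_sets[OF sets refl])
    show "\<bar>LINT x|\<mu>. g x\<bar> \<le> E" using g by (intro \<mu>.abs_expectation_le) auto
    show "\<bar>LINT x|\<nu>. g x\<bar> \<le> E" using g by (intro \<nu>.abs_expectation_le m) (auto simp: space)
  qed
  obtain x where "x \<in> space \<mu>" using \<mu>.not_empty by auto
  with bound[of x] have "0 \<le> D" by linarith
  \<comment> \<open>Scaling is impossible for \<open>D = 0\<close>, but then \<open>f\<close>
    vanishes and so do both integrals.\<close>
  then consider "D = 0" | "0 < D" by linarith
  then show ?thesis
  proof cases
    case 1
    then show ?thesis using int_le[OF f, of 0] bound by simp
  next
    case 2
    let ?g = "\<lambda>x. f x / D"
    let ?F = "{f \<in> borel_measurable \<mu>. \<forall>x\<in>space \<mu>. \<bar>f x\<bar> \<le> (1::real)}"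
    have "?g \<in> ?F" using 2 bound by auto
    moreover have "bdd_above ((\<lambda>f. \<bar>(LINT x|\<mu>. f x) - (LINT x|\<nu>. f x)\<bar>) ` ?F)"
    proof (rule bdd_aboveI2)
      fix g assume "g \<in> ?F"
      then have "\<bar>LINT x|\<mu>. g x\<bar> \<le> 1" "\<bar>LINT x|\<nu>. g x\<bar> \<le> 1" by (auto intro!: int_le)
      then show "\<bar>(LINT x|\<mu>. g x) - (LINT x|\<nu>. g x)\<bar> \<le> 2" by linarith
    qed
    ultimately have "\<bar>(LINT x|\<mu>. ?g x) - (LINT x|\<nu>. ?g x)\<bar> \<le> tv_dist \<mu> \<nu>"
      unfolding tv_dist_def by (rule cSUP_upper)
    then show ?thesis using 2 by (simp add: field_simps flip: diff_divide_distrib)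
  qed
qed

lemma INF_attained_finite:
  fixes f :: "'i \<Rightarrow> 'a::conditionally_complete_linorder"
  assumes "finite I" "I \<noteq> {}"
  obtains i where "i \<in> I" "(INF i\<in>I. f i) = f i"
proof -
  have "(INF i\<in>I. f i) \<in> f ` I"
    using assms by (simp add: cInf_eq_Min)
  then show thesis using that by auto
qed

lemma INF_lower_finite:
  fixes f :: "'i \<Rightarrow> 'a::conditionally_complete_linorder"
  assumes "finite I" "i \<in> I"
  shows "(INF i\<in>I. f i) \<le> f i"
  using assms by (intro cINF_lower) auto

lemma INF_mono_finite:
  fixes f :: "'i \<Rightarrow> 'a::conditionally_complete_linorder"
  assumes "finite I" "I \<noteq> {}" "\<And>i. i \<in> I \<Longrightarrow> f i \<le> g i"
  shows "(INF i\<in>I. f i) \<le> (INF i\<in>I. g i)"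
  using assms by (intro cINF_mono) auto

section \<open>The Bellman equation of a finite model\<close>

text \<open>The Bellman equation of a finite stochastic model, detached from quantization, so that
  uniqueness and bounds of its solution depend only on stochastic weights and costs in
  \<open>[0, D]\<close>.\<close>

locale finite_state_bellman =
  fixes S :: "'s set" and U :: "'u set" and C :: "'s \<Rightarrow> 'u \<Rightarrow> real"
    and P :: "'s \<Rightarrow> 's \<Rightarrow> 'u \<Rightarrow> real" and \<beta> D :: real
  assumes finite: "finite S" "finite U" "U \<noteq> {}"
    and discount: "0 < \<beta>" "\<beta> < 1"
    and P_nonneg: "\<And>z v u. z \<in> S \<Longrightarrow> v \<in> S \<Longrightarrow> u \<in> U \<Longrightarrow> 0 \<le> P z v u"
    and P_sum: "\<And>v u. v \<in> S \<Longrightarrow> u \<in> U \<Longrightarrow> (\<Sum>z\<in>S. P z v u) = 1"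
    and C_nonneg: "\<And>v u. v \<in> S \<Longrightarrow> u \<in> U \<Longrightarrow> 0 \<le> C v u"
    and C_le: "\<And>v u. v \<in> S \<Longrightarrow> u \<in> U \<Longrightarrow> C v u \<le> D"
begin

definition bellman :: "('s \<Rightarrow> real) \<Rightarrow> 's \<Rightarrow> real" where
  "bellman J v = (INF u\<in>U. C v u + \<beta> * (\<Sum>z\<in>S. J z * P z v u))"

lemma bellman_mono:
  assumes "v \<in> S" "\<And>z. z \<in> S \<Longrightarrow> J z \<le> J' z"
  shows "bellman J v \<le> bellman J' v"
  unfolding bellman_def using assms discount P_nonneg
  by (intro INF_mono_finite finite add_left_mono mult_left_mono sum_mono mult_right_mono) auto

text \<open>The weights sum to 1, so a constant passes through them and is only discounted. Together
  with monotonicity this is Blackwell's criterion for a contraction; the minimizer for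
  \<open>J\<close> serves as the trial action for the shifted function.\<close>

lemma bellman_add_const:
  assumes "v \<in> S"
  shows "bellman (\<lambda>z. J z + d) v \<le> bellman J v + \<beta> * d"
proof -
  obtain u where u: "u \<in> U" "bellman J v = C v u + \<beta> * (\<Sum>z\<in>S. J z * P z v u)"
    unfolding bellman_def by (rule INF_attained_finite[OF finite(2,3)])
  have "bellman (\<lambda>z. J z + d) v \<le> C v u + \<beta> * (\<Sum>z\<in>S. (J z + d) * P z v u)"
    unfolding bellman_def using u by (intro INF_lower_finite finite)
  also have "(\<Sum>z\<in>S. (J z + d) * P z v u) = (\<Sum>z\<in>S. J z * P z v u) + d"
    using P_sum[OF assms u(1)] by (simp add: distrib_right sum.distrib flip: sum_distrib_left)
  finally show ?thesis by (simp add: u distrib_left)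
qed

text \<open>Maximum principle: at a state \<open>w\<close> where \<open>J - J'\<close> takes its
  maximum \<open>d\<close>, the two preceding lemmas give \<open>d \<le> \<beta> * d\<close>, which
  forces \<open>d \<le> 0\<close>.\<close>

lemma bellman_fixed_point_le:
  assumes J: "\<And>v. v \<in> S \<Longrightarrow> J v = bellman J v" and J': "\<And>v. v \<in> S \<Longrightarrow> J' v = bellman J' v"
    and v: "v \<in> S"
  shows "J v \<le> J' v"
proof -
  define d where "d = Max ((\<lambda>v. J v - J' v) ` S)"
  have d_ge: "J z - J' z \<le> d" if "z \<in> S" for z
    unfolding d_def using finite that by (intro Max_ge) auto
  have "d \<in> (\<lambda>v. J v - J' v) ` S"
    unfolding d_def using finite v by (intro Max_in) auto
  then obtain w where w: "w \<in> S" "d = J w - J' w" by auto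
  have "J w \<le> bellman (\<lambda>z. J' z + d) w"
    unfolding J[OF w(1)] using d_ge by (intro bellman_mono w) (simp add: algebra_simps)
  also have "\<dots> \<le> J' w + \<beta> * d"
    using bellman_add_const[OF w(1), of J' d] J'[OF w(1)] by simp
  finally have "d \<le> \<beta> * d" using w(2) by linarith
  then have "(1 - \<beta>) * d \<le> 0" by (simp add: algebra_simps)
  then have "d \<le> 0" using discount by (simp add: mult_le_0_iff)
  then show ?thesis using d_ge[OF v] by simp
qed

text \<open>Value iteration from 0 increases, because costs are nonnegative and
  \<open>bellman\<close> is monotone, and stays below \<open>D / (1 - \<beta>)\<close>. Its limit is
  a fixed point since a minimum of finitely many finite sums is continuous, and it inherits both
  bounds.\<close>

lemma ex_bellman_fixed_point:
  "\<exists>J. J \<in> extensional S \<and> (\<forall>v\<in>S. J v = bellman J v) \<and> (\<forall>v\<in>S. 0 \<le> J v \<and> J v \<le> D / (1 - \<beta>))"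
proof -
  define J where "J n = (bellman ^^ n) (\<lambda>_. 0)" for n
  have J_Suc: "J (Suc n) = bellman (J n)" for n by (simp add: J_def)
  \<comment> \<open>The sign of \<open>D\<close> is read off from a cost, so a state must be at
    hand.\<close>
  have D: "0 \<le> D" if "v \<in> S" for v
    using finite(3) C_nonneg[OF that] C_le[OF that] by (meson ex_in_conv order_trans)
  have J_le: "J n v \<le> D / (1 - \<beta>)" if "v \<in> S" for n v
    using that
  proof (induction n arbitrary: v)
    case (Suc n)
    have "J (Suc n) v \<le> bellman (\<lambda>z. 0 + D / (1 - \<beta>)) v"
      unfolding J_Suc using Suc by (intro bellman_mono) auto
    also have "\<dots> \<le> bellman (\<lambda>z. 0) v + \<beta> * (D / (1 - \<beta>))"
      by (rule bellman_add_const[OF Suc.prems])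
    also have "bellman (\<lambda>z. 0) v \<le> D"
    proof -
      obtain u where u: "u \<in> U" using finite by auto
      have "bellman (\<lambda>z. 0) v \<le> C v u + \<beta> * (\<Sum>z\<in>S. 0 * P z v u)"
        unfolding bellman_def using u by (intro INF_lower_finite finite)
      then show ?thesis using C_le[OF Suc.prems u] by simp
    qed
    \<comment> \<open>The bound is the total of the geometric series of stage costs
      \<open>D\<close>, hence reproduced by one more stage.\<close>
    also have "D + \<beta> * (D / (1 - \<beta>)) = D / (1 - \<beta>)"
      using discount by (simp add: field_simps)
    finally show ?case by simp
  qed (use D discount in \<open>simp add: J_def\<close>)
  have J_mono: "J n v \<le> J (Suc n) v" if "v \<in> S" for n v
    using that
  proof (induction n arbitrary: v)
    case 0
    then show ?case
      unfolding J_Suc bellman_def using finite C_nonneg by (intro cINF_greatest) (auto simp: J_def)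
  next
    case (Suc n)
    then show ?case unfolding J_Suc[of "Suc n"] by (subst J_Suc) (intro bellman_mono, auto)
  qed
  \<comment> \<open>The restriction fixes the values off \<open>S\<close>, as
    \<open>finite_value\<close> demands of its solution.\<close>
  define L where "L = restrict (\<lambda>v. SUP n. J n v) S"
  have lim: "(\<lambda>n. J n v) \<longlonglongrightarrow> L v" if "v \<in> S" for v
    unfolding L_def using that J_le J_mono
    by (auto intro!: LIMSEQ_incseq_SUP incseq_SucI bdd_aboveI2)
  have "L v = bellman L v" if v: "v \<in> S" for v
  proof (rule LIMSEQ_unique)
    show "(\<lambda>n. J (Suc n) v) \<longlonglongrightarrow> L v" by (rule LIMSEQ_Suc[OF lim[OF v]])
    show "(\<lambda>n. J (Suc n) v) \<longlonglongrightarrow> bellman L v"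
      unfolding J_Suc bellman_def
      by (intro tendsto_INF_finite finite tendsto_add tendsto_mult tendsto_sum tendsto_const lim)
  qed
  moreover have "0 \<le> L v" if "v \<in> S" for v
    using incseq_le[OF incseq_SucI lim[OF that], of 0] J_mono[OF that] by (simp add: J_def)
  moreover have "L v \<le> D / (1 - \<beta>)" if "v \<in> S" for v
    using LIMSEQ_le_const2[OF lim[OF that]] J_le[OF that] by blast
  moreover have "L \<in> extensional S" by (simp add: L_def)
  ultimately show ?thesis by blast
qed

lemma ex1_bellman_fixed_point: "\<exists>!J. J \<in> extensional S \<and> (\<forall>v\<in>S. J v = bellman J v)"
proof (rule ex_ex1I)
  fix J J' assume J: "J \<in> extensional S \<and> (\<forall>v\<in>S. J v = bellman J v)"
    and J': "J' \<in> extensional S \<and> (\<forall>v\<in>S. J' v = bellman J' v)"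
  then have "J v = J' v" if "v \<in> S" for v
    using that bellman_fixed_point_le[of J J' v] bellman_fixed_point_le[of J' J v] by force
  with J J' show "J = J'" by (auto intro: extensionalityI)
qed (use ex_bellman_fixed_point in blast)

end

section \<open>Markov decision processes with finitely many actions\<close>

text \<open>Points are closed in a T1 space, so every subset of a finite set is closed: the action
  space is discrete as a measurable space.\<close>

lemma sets_borel_on_finite:
  fixes U :: "'u::t1_space set"
  assumes "finite U"
  shows "sets (borel_on U) = Pow U"
proof -
  have "A \<in> sets borel" if "A \<subseteq> U" for A
    using that assms by (intro borel_closed finite_imp_closed) (rule finite_subset)
  then show ?thesis
    by (auto simp: sets_restrict_space intro!: image_eqI)
qed

locale finite_action_mdp =
  fixes X :: "'a::topological_space set" and U :: "'u::t1_space set"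
    and T :: "'a \<Rightarrow> 'u \<Rightarrow> 'a measure" and \<beta> :: real
  assumes kernel: "(\<lambda>(x, u). T x u) \<in> (borel_on X \<Otimes>\<^sub>M borel_on U) \<rightarrow>\<^sub>M prob_algebra (borel_on X)"
    and finite_actions: "finite U" "U \<noteq> {}"
    and discount: "0 < \<beta>" "\<beta> < 1"
begin

abbreviation "S \<equiv> borel_on X \<Otimes>\<^sub>M borel_on U"

lemma space_S: "space S = X \<times> U"
  by (simp add: space_pair_measure space_restrict_space)

text \<open>As the actions form a finite discrete space, joint measurability follows from
  measurability in the state for each fixed action.\<close>

lemma measurable_actionwise:
  assumes "\<And>u. u \<in> U \<Longrightarrow> F u \<in> borel_on X \<rightarrow>\<^sub>M N"
  shows "(\<lambda>p. F (snd p) (fst p)) \<in> S \<rightarrow>\<^sub>M N"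
proof (rule measurable_compose_countable'[of U "\<lambda>u p. F u (fst p)"])
  show "(\<lambda>p. F u (fst p)) \<in> S \<rightarrow>\<^sub>M N" if "u \<in> U" for u
    by (rule measurable_compose[OF measurable_fst assms[OF that]])
  have "borel_on U \<rightarrow>\<^sub>M borel_on U = borel_on U \<rightarrow>\<^sub>M count_space U"
    by (rule measurable_cong_sets) (simp_all add: sets_borel_on_finite finite_actions)
  then have "(\<lambda>u. u) \<in> borel_on U \<rightarrow>\<^sub>M count_space U"
    using measurable_ident[of "borel_on U"] by (simp add: id_def)
  from measurable_compose[OF measurable_snd this]
  show "snd \<in> S \<rightarrow>\<^sub>M count_space U" .
  show "countable U" by (rule countable_finite[OF finite_actions(1)])
qed

lemma T_prob: "x \<in> X \<Longrightarrow> u \<in> U \<Longrightarrow> prob_space (T x u)"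
  and sets_T: "x \<in> X \<Longrightarrow> u \<in> U \<Longrightarrow> sets (T x u) = sets (borel_on X)"
  and space_T: "x \<in> X \<Longrightarrow> u \<in> U \<Longrightarrow> space (T x u) = X"
proof -
  assume "x \<in> X" "u \<in> U"
  then have "T x u \<in> space (prob_algebra (borel_on X))"
    using measurable_space[OF kernel, of "(x, u)"] by (simp add: space_S)
  then show "prob_space (T x u)" "sets (T x u) = sets (borel_on X)"
    by (auto simp: space_prob_algebra)
  from sets_eq_imp_space_eq[OF this(2)] show "space (T x u) = X"
    by (simp add: space_restrict_space)
qed

lemma measurable_T:
  assumes "u \<in> U" shows "(\<lambda>x. T x u) \<in> borel_on X \<rightarrow>\<^sub>M subprob_algebra (borel_on X)"
proof -
  have "(\<lambda>x. (x, u)) \<in> borel_on X \<rightarrow>\<^sub>M S"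
    using assms by (intro measurable_Pair) (auto simp: space_restrict_space)
  from measurable_compose[OF this measurable_prob_algebraD[OF kernel]] show ?thesis by simp
qed

lemma measurable_nn_integral_T:
  assumes "h \<in> borel_measurable (borel_on X)" "u \<in> U"
  shows "(\<lambda>x. \<integral>\<^sup>+x'. h x' \<partial>T x u) \<in> borel_measurable (borel_on X)"
  by (rule measurable_compose[OF measurable_T[OF assms(2)]
      nn_integral_measurable_subprob_algebra[OF assms(1)]])

lemma borel_measurable_T:
  "h \<in> borel_measurable (borel_on X) \<Longrightarrow> x \<in> X \<Longrightarrow> u \<in> U \<Longrightarrow> h \<in> borel_measurable (T x u)"
  by (simp add: measurable_cong_sets[OF sets_T refl])

lemma nn_integral_T_le:
  assumes "x \<in> X" "u \<in> U" and "\<And>x'. x' \<in> X \<Longrightarrow> h x' \<le> D"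
  shows "(\<integral>\<^sup>+x'. h x' \<partial>T x u) \<le> D"
proof -
  have "(\<integral>\<^sup>+x'. h x' \<partial>T x u) \<le> (\<integral>\<^sup>+x'. D \<partial>T x u)"
    using assms by (intro nn_integral_mono) (simp add: space_T)
  also have "\<dots> = D"
    using prob_space.emeasure_space_1[OF T_prob[OF assms(1,2)]] by simp
  finally show ?thesis .
qed

section \<open>Expectations at a single time\<close>

definition mean :: "'a \<Rightarrow> ('a, 'u) policy \<Rightarrow> nat \<Rightarrow> ('a \<times> 'u \<Rightarrow> ennreal) \<Rightarrow> ennreal" where
  "mean x0 \<gamma> t k = (\<integral>\<^sup>+\<omega>. k (\<omega> t) \<partial>trajectory_law X U T x0 \<gamma>)"

context
  fixes x0 \<gamma>
  assumes x0: "x0 \<in> X" and \<gamma>: "\<gamma> \<in> admissible_policies X U"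
begin

interpretation IT: Ionescu_Tulcea "step_law X U T x0 \<gamma>" "\<lambda>_. S"
  by (rule Ionescu_Tulcea_step_law[OF kernel \<gamma> x0])

lemma trajectory_eq_lim: "trajectory_law X U T x0 \<gamma> = IT.PF.lim"
  by (simp add: trajectory_law_def)

lemma prob_space_trajectory: "prob_space (trajectory_law X U T x0 \<gamma>)"
  by (rule trajectory_law_well_formed) (rule IT.Ionescu_Tulcea_axioms)

lemma sets_trajectory: "sets (trajectory_law X U T x0 \<gamma>) = sets (PiM UNIV (\<lambda>_. S))"
  by (rule trajectory_law_well_formed) (rule IT.Ionescu_Tulcea_axioms)

lemma space_trajectory: "space (trajectory_law X U T x0 \<gamma>) = (UNIV \<rightarrow>\<^sub>E X \<times> U)"
  using sets_eq_imp_space_eq[OF sets_trajectory] by (simp add: space_PiM space_S)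

lemma trajectory_component:
  "(\<lambda>\<omega>. \<omega> t) \<in> trajectory_law X U T x0 \<gamma> \<rightarrow>\<^sub>M S"
  unfolding measurable_cong_sets[OF sets_trajectory refl]
  by (rule measurable_component_singleton) simp

lemma mean_mono:
  assumes "\<And>x u. x \<in> X \<Longrightarrow> u \<in> U \<Longrightarrow> h (x, u) \<le> k (x, u)"
  shows "mean x0 \<gamma> t h \<le> mean x0 \<gamma> t k"
  unfolding mean_def
proof (rule nn_integral_mono)
  fix \<omega> assume "\<omega> \<in> space (trajectory_law X U T x0 \<gamma>)"
  then have "\<omega> t \<in> X \<times> U" by (auto simp: space_trajectory PiE_iff)
  then show "h (\<omega> t) \<le> k (\<omega> t)" using assms by auto
qed

lemma mean_add:
  assumes [measurable]: "h \<in> borel_measurable S" "k \<in> borel_measurable S"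
  shows "mean x0 \<gamma> t (\<lambda>p. h p + k p) = mean x0 \<gamma> t h + mean x0 \<gamma> t k"
proof -
  note [measurable] = trajectory_component
  show ?thesis unfolding mean_def by (rule nn_integral_add) measurable
qed

lemma mean_cmult:
  assumes [measurable]: "h \<in> borel_measurable S"
  shows "mean x0 \<gamma> t (\<lambda>p. D * h p) = D * mean x0 \<gamma> t h"
proof -
  note [measurable] = trajectory_component
  show ?thesis unfolding mean_def by (rule nn_integral_cmult) measurable
qed

lemma mean_const: "mean x0 \<gamma> t (\<lambda>_. D) = D"
  unfolding mean_def using prob_space.emeasure_space_1[OF prob_space_trajectory] by simp

lemma mean_le:
  assumes "\<And>x u. x \<in> X \<Longrightarrow> u \<in> U \<Longrightarrow> h (x, u) \<le> D"
  shows "mean x0 \<gamma> t h \<le> D"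
  using mean_mono[of h "\<lambda>_. D" t] assms by (simp add: mean_const)

text \<open>\<open>step_law\<close> at time \<open>t\<close> reads only coordinates before
  \<open>t\<close>, so the restriction of the history in \<open>nn_integral_lim_component\<close>
  can be removed.\<close>

lemma mean_step_law:
  assumes k[measurable]: "k \<in> borel_measurable S"
  shows "mean x0 \<gamma> t k = (\<integral>\<^sup>+\<omega>. (\<integral>\<^sup>+p. k p \<partial>step_law X U T x0 \<gamma> t \<omega>) \<partial>trajectory_law X U T x0 \<gamma>)"
proof -
  have "step_law X U T x0 \<gamma> t (restrict \<omega> {0..<t}) = step_law X U T x0 \<gamma> t \<omega>" for \<omega>
  proof -
    have "(\<lambda>s\<in>{..t}. if s < t then fst (restrict \<omega> {0..<t} s) else x)
        = (\<lambda>s\<in>{..t}. if s < t then fst (\<omega> s) else x)"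
      "(\<lambda>s\<in>{..<t}. snd (restrict \<omega> {0..<t} s)) = (\<lambda>s\<in>{..<t}. snd (\<omega> s))" for x
      by (auto simp: fun_eq_iff)
    then show ?thesis unfolding step_law_def by simp
  qed
  then show ?thesis
    unfolding mean_def trajectory_eq_lim by (simp add: IT.nn_integral_lim_component[OF k])
qed

text \<open>The step law is an image measure. Freezing a history of valid pairs leaves the action a
  measurable function of the current state alone, which justifies the change of variables.\<close>

lemma nn_integral_step_law:
  assumes k: "k \<in> borel_measurable S" and \<omega>: "\<And>s. s < t \<Longrightarrow> \<omega> s \<in> X \<times> U"
  shows "(\<integral>\<^sup>+p. k p \<partial>step_law X U T x0 \<gamma> t \<omega>) =
    (\<integral>\<^sup>+x. k (x, \<gamma> t (\<lambda>s\<in>{..t}. if s < t then fst (\<omega> s) else x, \<lambda>s\<in>{..<t}. snd (\<omega> s)))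
      \<partial>(if t = 0 then return (borel_on X) x0 else T (fst (\<omega> (t - 1))) (snd (\<omega> (t - 1)))))"
proof -
  let ?\<nu> = "if t = 0 then return (borel_on X) x0 else T (fst (\<omega> (t - 1))) (snd (\<omega> (t - 1)))"
  have "sets ?\<nu> = sets (borel_on X)"
    using \<omega>[of "t - 1"] by (cases "t = 0") (auto simp: sets_T)
  note cong = measurable_cong_sets[OF this refl]
  have g: "\<gamma> t \<in> (PiM {..t} (\<lambda>_. borel_on X) \<Otimes>\<^sub>M PiM {..<t} (\<lambda>_. borel_on U)) \<rightarrow>\<^sub>M borel_on U"
    using \<gamma> by (auto simp: admissible_policies_def)
  have 1: "(\<lambda>x. \<lambda>s\<in>{..t}. if s < t then fst (\<omega> s) else x) \<in> borel_on X \<rightarrow>\<^sub>M PiM {..t} (\<lambda>_. borel_on X)"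
  proof (rule measurable_restrict)
    show "(\<lambda>x. if s < t then fst (\<omega> s) else x) \<in> borel_on X \<rightarrow>\<^sub>M borel_on X" for s
      using \<omega>[of s] by (cases "s < t") (auto simp: space_restrict_space)
  qed
  have 2: "(\<lambda>x. \<lambda>s\<in>{..<t}. snd (\<omega> s)) \<in> borel_on X \<rightarrow>\<^sub>M PiM {..<t} (\<lambda>_. borel_on U)"
    using \<omega> by (intro measurable_restrict measurable_const) (fastforce simp: space_restrict_space mem_Times_iff)
  have "(\<lambda>x. (x, \<gamma> t (\<lambda>s\<in>{..t}. if s < t then fst (\<omega> s) else x, \<lambda>s\<in>{..<t}. snd (\<omega> s)))) \<in> ?\<nu> \<rightarrow>\<^sub>M S"
    unfolding cong by (intro measurable_Pair measurable_ident_sets refl measurable_compose[OF measurable_Pair[OF 1 2] g])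
  from nn_integral_distr[OF this, of k] k show ?thesis
    unfolding step_law_def by simp
qed

lemma mean_0:
  assumes [measurable]: "h \<in> borel_measurable (borel_on X)"
  shows "mean x0 \<gamma> 0 (\<lambda>p. h (fst p)) = h x0"
proof -
  have "mean x0 \<gamma> 0 (\<lambda>p. h (fst p)) = (\<integral>\<^sup>+\<omega>. h x0 \<partial>trajectory_law X U T x0 \<gamma>)"
    by (subst mean_step_law)
      (auto intro!: nn_integral_cong simp: nn_integral_step_law nn_integral_return x0 space_restrict_space)
  then show ?thesis
    using prob_space.emeasure_space_1[OF prob_space_trajectory] by simp
qed

text \<open>Given the past, the next state has the law \<open>T\<close> of the current pair whatever
  the policy. For functions of the state alone the action at the new time drops out, so the identity
  holds for every admissible policy.\<close>

lemma mean_Suc: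
  assumes [measurable]: "h \<in> borel_measurable (borel_on X)"
  shows "mean x0 \<gamma> (Suc t) (\<lambda>p. h (fst p)) = mean x0 \<gamma> t (\<lambda>p. \<integral>\<^sup>+x. h x \<partial>T (fst p) (snd p))"
proof (subst mean_step_law)
  show "(\<integral>\<^sup>+\<omega>. (\<integral>\<^sup>+p. h (fst p) \<partial>step_law X U T x0 \<gamma> (Suc t) \<omega>) \<partial>trajectory_law X U T x0 \<gamma>)
      = mean x0 \<gamma> t (\<lambda>p. \<integral>\<^sup>+x. h x \<partial>T (fst p) (snd p))"
    unfolding mean_def
  proof (rule nn_integral_cong)
    fix \<omega> assume "\<omega> \<in> space (trajectory_law X U T x0 \<gamma>)"
    then have "\<omega> s \<in> X \<times> U" for s by (auto simp: space_trajectory PiE_iff)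
    then show "(\<integral>\<^sup>+p. h (fst p) \<partial>step_law X U T x0 \<gamma> (Suc t) \<omega>) = (\<integral>\<^sup>+x. h x \<partial>T (fst (\<omega> t)) (snd (\<omega> t)))"
      by (subst nn_integral_step_law) auto
  qed
qed measurable

text \<open>Passes from the real Bochner integral of a real series to a series of
  \<open>ennreal\<close> expectations, in which all further comparisons are made.\<close>

lemma
  assumes c[measurable]: "(\<lambda>(x, u). c x u) \<in> borel_measurable S"
    and bound: "\<And>x u. x \<in> X \<Longrightarrow> u \<in> U \<Longrightarrow> 0 \<le> c x u \<and> c x u \<le> D"
  shows discounted_cost_nonneg: "0 \<le> discounted_cost X U T c \<beta> x0 \<gamma>"
    and discounted_cost_eq: "ennreal (discounted_cost X U T c \<beta> x0 \<gamma>) =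
    (\<Sum>t. ennreal \<beta> ^ t * mean x0 \<gamma> t (\<lambda>p. ennreal (c (fst p) (snd p))))"
proof -
  let ?P = "trajectory_law X U T x0 \<gamma>"
  interpret prob_space ?P by (rule prob_space_trajectory)
  note [measurable] = trajectory_component
  have c'[measurable]: "(\<lambda>p. c (fst p) (snd p)) \<in> borel_measurable S"
    using c by (simp add: case_prod_beta)
  have m[measurable]: "(\<lambda>\<omega>. c (fst (\<omega> t)) (snd (\<omega> t))) \<in> borel_measurable ?P" for t
    by (rule measurable_compose[OF trajectory_component c'])
  have in_X: "0 \<le> c (fst (\<omega> t)) (snd (\<omega> t)) \<and> c (fst (\<omega> t)) (snd (\<omega> t)) \<le> D" if "\<omega> \<in> space ?P" for \<omega> t
  proof -
    have "\<omega> t \<in> X \<times> U" using that by (auto simp: space_trajectory PiE_iff)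
    then show ?thesis by (intro bound) auto
  qed
  \<comment> \<open>This geometric majorant gives both convergence along each trajectory and
    integrability of the sum.\<close>
  have summ: "summable (\<lambda>t. \<beta> ^ t * D)"
    using discount by (intro summable_mult2 summable_geometric) auto
  have le: "\<beta> ^ t * c (fst (\<omega> t)) (snd (\<omega> t)) \<le> \<beta> ^ t * D" if "\<omega> \<in> space ?P" for \<omega> t
    using in_X[OF that] discount by (intro mult_left_mono) auto
  have nn: "0 \<le> \<beta> ^ t * c (fst (\<omega> t)) (snd (\<omega> t))" if "\<omega> \<in> space ?P" for \<omega> t
    using in_X[OF that] discount by auto
  have summ': "summable (\<lambda>t. \<beta> ^ t * c (fst (\<omega> t)) (snd (\<omega> t)))" if "\<omega> \<in> space ?P" for \<omega>
    by (rule summable_comparison_test'[OF summ, of 0]) (use le[OF that] nn[OF that] in auto)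
  show "0 \<le> discounted_cost X U T c \<beta> x0 \<gamma>"
    unfolding discounted_cost_def by (intro integral_nonneg_AE AE_I2 suminf_nonneg summ' nn)
  have "ennreal (discounted_cost X U T c \<beta> x0 \<gamma>)
      = (\<integral>\<^sup>+\<omega>. ennreal (\<Sum>t. \<beta> ^ t * c (fst (\<omega> t)) (snd (\<omega> t))) \<partial>?P)"
    unfolding discounted_cost_def
  proof (rule nn_integral_eq_integral[symmetric])
    show "AE \<omega> in ?P. 0 \<le> (\<Sum>t. \<beta> ^ t * c (fst (\<omega> t)) (snd (\<omega> t)))"
      by (intro AE_I2 suminf_nonneg summ' nn)
    show "integrable ?P (\<lambda>\<omega>. \<Sum>t. \<beta> ^ t * c (fst (\<omega> t)) (snd (\<omega> t)))"
    proof (rule integrable_const_bound[where B="\<Sum>t. \<beta> ^ t * D"])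
      show "AE \<omega> in ?P. norm (\<Sum>t. \<beta> ^ t * c (fst (\<omega> t)) (snd (\<omega> t))) \<le> (\<Sum>t. \<beta> ^ t * D)"
      proof (rule AE_I2)
        fix \<omega> assume "\<omega> \<in> space ?P"
        from suminf_nonneg[OF summ'[OF this] nn[OF this]] suminf_le[OF le[OF this] summ'[OF this] summ]
        show "norm (\<Sum>t. \<beta> ^ t * c (fst (\<omega> t)) (snd (\<omega> t))) \<le> (\<Sum>t. \<beta> ^ t * D)" by simp
      qed
    qed measurable
  qed
  also have "\<dots> = (\<integral>\<^sup>+\<omega>. (\<Sum>t. ennreal \<beta> ^ t * ennreal (c (fst (\<omega> t)) (snd (\<omega> t)))) \<partial>?P)"
  proof (rule nn_integral_cong)
    fix \<omega> assume \<omega>: "\<omega> \<in> space ?P"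
    from suminf_ennreal2[OF nn[OF this] summ'[OF this]] in_X[OF \<omega>] discount
    show "ennreal (\<Sum>t. \<beta> ^ t * c (fst (\<omega> t)) (snd (\<omega> t)))
        = (\<Sum>t. ennreal \<beta> ^ t * ennreal (c (fst (\<omega> t)) (snd (\<omega> t))))"
      by (simp add: ennreal_mult ennreal_power)
  qed
  also have "\<dots> = (\<Sum>t. \<integral>\<^sup>+\<omega>. ennreal \<beta> ^ t * ennreal (c (fst (\<omega> t)) (snd (\<omega> t))) \<partial>?P)"
    by (rule nn_integral_suminf) measurable
  also have "\<dots> = (\<Sum>t. ennreal \<beta> ^ t * mean x0 \<gamma> t (\<lambda>p. ennreal (c (fst p) (snd p))))"
    unfolding mean_def by (intro suminf_cong nn_integral_cmult) measurable
  finally show "ennreal (discounted_cost X U T c \<beta> x0 \<gamma>) =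
    (\<Sum>t. ennreal \<beta> ^ t * mean x0 \<gamma> t (\<lambda>p. ennreal (c (fst p) (snd p))))" .
qed

text \<open>\<open>measure_of\<close> yields the intended values only if the set function is a
  measure. It is recognized as the law of the state at an independent geometric time, that is, as a
  mixture \<open>?w \<bind> ?N\<close>, and mixtures have a known integral.\<close>

lemma nn_integral_occupation_measure:
  assumes h[measurable]: "h \<in> borel_measurable (borel_on X)"
  shows "(\<integral>\<^sup>+x. h x \<partial>occupation_measure X U T \<beta> x0 \<gamma>) =
    ennreal (1 - \<beta>) * (\<Sum>t. ennreal \<beta> ^ t * mean x0 \<gamma> t (\<lambda>p. h (fst p)))"
proof -
  let ?P = "trajectory_law X U T x0 \<gamma>"
  let ?w = "density (count_space UNIV) (\<lambda>t::nat. ennreal (1 - \<beta>) * ennreal \<beta> ^ t)"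
  let ?N = "\<lambda>t. distr ?P (borel_on X) (\<lambda>\<omega>. fst (\<omega> t))"
  interpret prob_space ?P by (rule prob_space_trajectory)
  have X1: "(\<lambda>\<omega>. fst (\<omega> t)) \<in> ?P \<rightarrow>\<^sub>M borel_on X" for t
    by (rule measurable_compose[OF trajectory_component measurable_fst])
  have N: "?N \<in> ?w \<rightarrow>\<^sub>M subprob_algebra (borel_on X)"
    by (auto simp: space_subprob_algebra intro!: prob_space_imp_subprob_space prob_space_distr X1)
  have w: "(\<integral>\<^sup>+t. g t \<partial>?w) = ennreal (1 - \<beta>) * (\<Sum>t. ennreal \<beta> ^ t * g t)" for g
    by (simp add: nn_integral_density nn_integral_count_space_nat mult.assoc)
  have bind: "space (?w \<bind> ?N) = X" "sets (?w \<bind> ?N) = sets (borel_on X)"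
    using space_bind[of ?w ?N "borel_on X"] sets_bind[of ?w ?N "borel_on X"]
    by (auto simp: space_restrict_space)
  \<comment> \<open>Replacing the set function inside \<open>measure_of\<close> by the
    \<open>emeasure\<close> of an existing measure saves a direct proof of countable
    additivity.\<close>
  have "occupation_measure X U T \<beta> x0 \<gamma> = measure_of (space (?w \<bind> ?N)) (sets (?w \<bind> ?N)) (emeasure (?w \<bind> ?N))"
    unfolding occupation_measure_def bind
  proof (rule measure_of_eq)
    show "sets (borel_on X) \<subseteq> Pow X"
      using sets.space_closed[of "borel_on X"] by (simp add: space_restrict_space)
    have sigma: "sigma_sets X (sets (borel_on X)) = sets (borel_on X)"
      using sets.sigma_sets_eq[of "borel_on X"] by (simp add: space_restrict_space)
    fix A assume "A \<in> sigma_sets X (sets (borel_on X))"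
    then have A: "A \<in> sets (borel_on X)" unfolding sigma .
    have "emeasure (?w \<bind> ?N) A = (\<integral>\<^sup>+t. emeasure (?N t) A \<partial>?w)"
      by (rule emeasure_bind[OF _ N A]) simp
    also have "\<dots> = ennreal (1 - \<beta>) * (\<Sum>t. ennreal (\<beta> ^ t) * emeasure ?P {\<omega> \<in> space ?P. fst (\<omega> t) \<in> A})"
      unfolding w using discount
      by (auto simp: emeasure_distr[OF X1 A] ennreal_power vimage_def Int_def conj_commute
          intro!: arg_cong2[where f="(*)"] suminf_cong arg_cong2[where f=emeasure])
    finally show "ennreal (1 - \<beta>) * (\<Sum>t. ennreal (\<beta> ^ t) * emeasure ?P {\<omega> \<in> space ?P. fst (\<omega> t) \<in> A})
        = emeasure (?w \<bind> ?N) A" ..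
  qed
  then have "occupation_measure X U T \<beta> x0 \<gamma> = ?w \<bind> ?N"
    by (simp only: measure_of_of_measure)
  then show ?thesis
    by (simp add: nn_integral_bind[OF h N] w nn_integral_distr[OF X1] mean_def)
qed

end

section \<open>Stationary policies\<close>

abbreviation stationary :: "('a \<Rightarrow> 'u) \<Rightarrow> ('a, 'u) policy" where
  "stationary f \<equiv> \<lambda>t (xs, us). f (xs t)"

lemma stationary_in:
  "f \<in> borel_on X \<rightarrow>\<^sub>M borel_on U \<Longrightarrow> stationary f \<in> stationary_policies X U"
  by (auto simp: stationary_policies_def)

lemma stationary_policy_admissible:
  "f \<in> borel_on X \<rightarrow>\<^sub>M borel_on U \<Longrightarrow> stationary f \<in> admissible_policies X U"
  using stationary_in[of f] stationary_admissible[of X U] by blast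

text \<open>The step law of a stationary policy lives on the graph of \<open>f\<close>, so the
  current action may be replaced by \<open>f\<close> of the current state. This lets inequalities
  that hold only for the action \<open>f x\<close> be used.\<close>

lemma mean_stationary:
  assumes f[measurable]: "f \<in> borel_on X \<rightarrow>\<^sub>M borel_on U" and x0: "x0 \<in> X"
    and k[measurable]: "k \<in> borel_measurable S"
  shows "mean x0 (stationary f) t k = mean x0 (stationary f) t (\<lambda>p. k (fst p, f (fst p)))"
proof -
  note \<gamma> = stationary_policy_admissible[OF f]
  have k': "(\<lambda>p. k (fst p, f (fst p))) \<in> borel_measurable S" by measurable
  show ?thesis
    unfolding mean_step_law[OF x0 \<gamma> k] mean_step_law[OF x0 \<gamma> k']
  proof (rule nn_integral_cong)
    fix \<omega> assume "\<omega> \<in> space (trajectory_law X U T x0 (stationary f))"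
    then have "\<omega> s \<in> X \<times> U" for s by (auto simp: space_trajectory[OF x0 \<gamma>] PiE_iff)
    then show "(\<integral>\<^sup>+p. k p \<partial>step_law X U T x0 (stationary f) t \<omega>)
        = (\<integral>\<^sup>+p. k (fst p, f (fst p)) \<partial>step_law X U T x0 (stationary f) t \<omega>)"
      by (simp add: nn_integral_step_law[OF x0 \<gamma> k] nn_integral_step_law[OF x0 \<gamma> k'])
  qed
qed

section \<open>Dynamic programming\<close>

text \<open>Value iteration from 0 increases, stays measurable and stays below the total
  \<open>D / (1 - \<beta>)\<close>. Monotone convergence carries its supremum through the integrals,
  and finiteness of \<open>U\<close> carries it through the infimum.\<close>

lemma bellman_solution:
  fixes k :: "'a \<Rightarrow> 'u \<Rightarrow> ennreal"
  assumes k: "\<And>u. u \<in> U \<Longrightarrow> (\<lambda>x. k x u) \<in> borel_measurable (borel_on X)"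
    and bound: "0 \<le> D" "\<And>x u. x \<in> X \<Longrightarrow> u \<in> U \<Longrightarrow> k x u \<le> ennreal D"
  obtains V where "V \<in> borel_measurable (borel_on X)"
    "\<And>x. x \<in> X \<Longrightarrow> V x \<le> ennreal (D / (1 - \<beta>))"
    "\<And>x. x \<in> X \<Longrightarrow> V x = (INF u\<in>U. k x u + ennreal \<beta> * (\<integral>\<^sup>+x'. V x' \<partial>T x u))"
proof -
  define L where "L v x = (INF u\<in>U. k x u + ennreal \<beta> * (\<integral>\<^sup>+x'. v x' \<partial>T x u))" for v x
  define v where "v n = (L ^^ n) (\<lambda>_. 0)" for n
  have v_Suc: "v (Suc n) = L (v n)" for n by (simp add: v_def)
  have L_mono: "L v x \<le> L w x" if "x \<in> X" "\<And>x. x \<in> X \<Longrightarrow> v x \<le> w x" for v w x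
    unfolding L_def
    using that by (intro INF_superset_mono add_left_mono mult_left_mono nn_integral_mono) (auto simp: space_T)
  have v_meas: "v n \<in> borel_measurable (borel_on X)" for n
  proof (induction n)
    case (Suc n)
    have "(\<lambda>x. k x u + ennreal \<beta> * (\<integral>\<^sup>+x'. v n x' \<partial>T x u)) \<in> borel_measurable (borel_on X)" if "u \<in> U" for u
    proof -
      note [measurable] = k[OF that] measurable_nn_integral_T[OF Suc that]
      show ?thesis by measurable
    qed
    then show ?case
      unfolding v_Suc L_def[abs_def]
      by (intro borel_measurable_INF countable_finite finite_actions)
  qed (simp add: v_def)
  have v_mono: "v n x \<le> v (Suc n) x" if "x \<in> X" for n x
    using that
  proof (induction n arbitrary: x)
    case (Suc n)
    show ?case unfolding v_Suc by (rule L_mono) (use Suc in \<open>auto simp: v_Suc\<close>)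
  qed (simp add: v_def)
  have v_le: "v n x \<le> ennreal (D / (1 - \<beta>))" if "x \<in> X" for n x
    using that
  proof (induction n arbitrary: x)
    case (Suc n)
    obtain u where u: "u \<in> U" using finite_actions by auto
    have "v (Suc n) x \<le> k x u + ennreal \<beta> * (\<integral>\<^sup>+x'. v n x' \<partial>T x u)"
      unfolding v_Suc L_def by (rule INF_lower[OF u])
    also have "\<dots> \<le> ennreal D + ennreal \<beta> * ennreal (D / (1 - \<beta>))"
      using Suc u by (intro add_mono mult_left_mono bound nn_integral_T_le) auto
    also have "\<dots> = ennreal (D + \<beta> * (D / (1 - \<beta>)))"
      using discount bound(1) by (simp add: ennreal_mult'[symmetric] flip: ennreal_plus)
    also have "D + \<beta> * (D / (1 - \<beta>)) = D / (1 - \<beta>)"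
      using discount by (simp add: field_simps)
    finally show ?case .
  qed (simp add: v_def)
  define V where "V x = (SUP n. v n x)" for x
  have V_lim: "(\<lambda>n. v n x) \<longlonglongrightarrow> V x" if "x \<in> X" for x
    unfolding V_def by (intro LIMSEQ_SUP incseq_SucI v_mono that)
  have V_fix: "V x = L V x" if x: "x \<in> X" for x
  proof -
    have "(\<lambda>n. L (v n) x) \<longlonglongrightarrow> L V x"
      unfolding L_def
    proof (intro tendsto_INF_finite finite_actions tendsto_add tendsto_const ennreal_tendsto_cmult)
      fix u assume u: "u \<in> U"
      have "(\<integral>\<^sup>+x'. V x' \<partial>T x u) = (SUP n. \<integral>\<^sup>+x'. v n x' \<partial>T x u)"
        unfolding V_def
        by (rule nn_integral_monotone_convergence_SUP_AE)
          (auto intro!: AE_I2 v_mono borel_measurable_T v_meas simp: x u space_T)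
      moreover have "incseq (\<lambda>n. \<integral>\<^sup>+x'. v n x' \<partial>T x u)"
        by (intro incseq_SucI nn_integral_mono v_mono) (simp add: space_T x u)
      ultimately show "(\<lambda>n. \<integral>\<^sup>+x'. v n x' \<partial>T x u) \<longlonglongrightarrow> (\<integral>\<^sup>+x'. V x' \<partial>T x u)"
        using LIMSEQ_SUP by metis
    qed simp
    moreover have "(\<lambda>n. L (v n) x) \<longlonglongrightarrow> V x"
      using LIMSEQ_Suc[OF V_lim[OF x]] by (simp add: v_Suc)
    ultimately show ?thesis by (intro LIMSEQ_unique)
  qed
  show thesis
  proof
    show "V \<in> borel_measurable (borel_on X)"
      unfolding V_def[abs_def] using v_meas by (intro borel_measurable_SUP) auto
    show "V x \<le> ennreal (D / (1 - \<beta>))" if "x \<in> X" for x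
      unfolding V_def using v_le[OF that] by (rule SUP_least)
    show "V x = (INF u\<in>U. k x u + ennreal \<beta> * (\<integral>\<^sup>+x'. V x' \<partial>T x u))" if "x \<in> X" for x
      using V_fix[OF that] by (simp add: L_def)
  qed
qed

lemma measurable_cost_to_go:
  assumes "\<And>u. u \<in> U \<Longrightarrow> (\<lambda>x. k x u) \<in> borel_measurable (borel_on X)" "h \<in> borel_measurable (borel_on X)"
  shows "(\<lambda>p. k (fst p) (snd p)) \<in> borel_measurable S"
    "(\<lambda>p. \<integral>\<^sup>+x'. h x' \<partial>T (fst p) (snd p)) \<in> borel_measurable S"
  using measurable_actionwise[of "\<lambda>u x. k x u"] measurable_actionwise[of "\<lambda>u x. \<integral>\<^sup>+x'. h x' \<partial>T x u"]
    assms measurable_nn_integral_T by auto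

lemma policy_actions_in:
  "f \<in> borel_on X \<rightarrow>\<^sub>M borel_on U \<Longrightarrow> x \<in> X \<Longrightarrow> f x \<in> U"
  using measurable_space[of f "borel_on X" "borel_on U" x] by (simp add: space_restrict_space)

text \<open>If one step under \<open>f\<close> raises \<open>h\<close> by at most \<open>l\<close>,
  taking expectations turns this into the hypothesis of \<open>discounted_sum_le\<close> with
  \<open>a t\<close> the expectation of \<open>h\<close> at time \<open>t\<close>.\<close>

lemma stationary_cost_le:
  assumes f: "f \<in> borel_on X \<rightarrow>\<^sub>M borel_on U" and x0: "x0 \<in> X"
    and k: "\<And>u. u \<in> U \<Longrightarrow> (\<lambda>x. k x u) \<in> borel_measurable (borel_on X)"
    and [measurable]: "h \<in> borel_measurable (borel_on X)" "l \<in> borel_measurable (borel_on X)"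
    and le: "\<And>x. x \<in> X \<Longrightarrow> k x (f x) + ennreal \<beta> * (\<integral>\<^sup>+x'. h x' \<partial>T x (f x)) \<le> h x + l x"
  shows "(\<Sum>t. ennreal \<beta> ^ t * mean x0 (stationary f) t (\<lambda>p. k (fst p) (snd p)))
    \<le> h x0 + (\<Sum>t. ennreal \<beta> ^ t * mean x0 (stationary f) t (\<lambda>p. l (fst p)))"
proof -
  note \<gamma> = stationary_policy_admissible[OF f]
  note [measurable] = measurable_cost_to_go[OF k assms(4)] f
  let ?E = "mean x0 (stationary f)"
  have "?E t (\<lambda>p. k (fst p) (snd p)) + ennreal \<beta> * ?E (Suc t) (\<lambda>p. h (fst p))
      \<le> ?E t (\<lambda>p. h (fst p)) + ?E t (\<lambda>p. l (fst p))" for t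
  proof -
    let ?g = "\<lambda>p. k (fst p) (snd p) + ennreal \<beta> * (\<integral>\<^sup>+x'. h x' \<partial>T (fst p) (snd p))"
    have "?E t (\<lambda>p. k (fst p) (snd p)) + ennreal \<beta> * ?E (Suc t) (\<lambda>p. h (fst p)) = ?E t ?g"
      by (simp add: mean_Suc[OF x0 \<gamma>] mean_add[OF x0 \<gamma>] mean_cmult[OF x0 \<gamma>])
    also have "\<dots> = ?E t (\<lambda>p. ?g (fst p, f (fst p)))"
      by (rule mean_stationary[OF f x0]) measurable
    also have "\<dots> \<le> ?E t (\<lambda>p. h (fst p) + l (fst p))"
      using le by (intro mean_mono[OF x0 \<gamma>]) simp
    also have "\<dots> = ?E t (\<lambda>p. h (fst p)) + ?E t (\<lambda>p. l (fst p))"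
      by (rule mean_add[OF x0 \<gamma>]) measurable
    finally show ?thesis .
  qed
  from discounted_sum_le[of "\<lambda>t. ?E t (\<lambda>p. k (fst p) (snd p))" _ "\<lambda>t. ?E t (\<lambda>p. h (fst p))", OF this]
  show ?thesis by (simp add: mean_0[OF x0 \<gamma>])
qed

text \<open>The inequality is required for every action, so it can be averaged along any
  history-dependent policy.\<close>

lemma le_policy_cost:
  assumes \<gamma>: "\<gamma> \<in> admissible_policies X U" and x0: "x0 \<in> X"
    and k: "\<And>u. u \<in> U \<Longrightarrow> (\<lambda>x. k x u) \<in> borel_measurable (borel_on X)"
    and [measurable]: "h \<in> borel_measurable (borel_on X)"
    and bound: "\<And>x. x \<in> X \<Longrightarrow> h x \<le> ennreal D"
    and le: "\<And>x u. x \<in> X \<Longrightarrow> u \<in> U \<Longrightarrow> h x \<le> k x u + ennreal \<beta> * (\<integral>\<^sup>+x'. h x' \<partial>T x u)"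
  shows "h x0 \<le> (\<Sum>t. ennreal \<beta> ^ t * mean x0 \<gamma> t (\<lambda>p. k (fst p) (snd p)))"
proof -
  note [measurable] = measurable_cost_to_go[OF k assms(4)]
  have "mean x0 \<gamma> t (\<lambda>p. h (fst p))
      \<le> mean x0 \<gamma> t (\<lambda>p. k (fst p) (snd p)) + ennreal \<beta> * mean x0 \<gamma> (Suc t) (\<lambda>p. h (fst p))" for t
  proof -
    have "mean x0 \<gamma> t (\<lambda>p. h (fst p))
      \<le> mean x0 \<gamma> t (\<lambda>p. k (fst p) (snd p) + ennreal \<beta> * (\<integral>\<^sup>+x'. h x' \<partial>T (fst p) (snd p)))"
      using le by (intro mean_mono[OF x0 \<gamma>]) simp
    then show ?thesis
      by (simp add: mean_Suc[OF x0 \<gamma>] mean_add[OF x0 \<gamma>] mean_cmult[OF x0 \<gamma>])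
  qed
  moreover have "mean x0 \<gamma> t (\<lambda>p. h (fst p)) \<le> ennreal D" for t
    using bound by (intro mean_le[OF x0 \<gamma>]) simp
  ultimately have "mean x0 \<gamma> 0 (\<lambda>p. h (fst p))
      \<le> (\<Sum>t. ennreal \<beta> ^ t * mean x0 \<gamma> t (\<lambda>p. k (fst p) (snd p)))"
    using discount by (intro le_discounted_sum[of \<beta>]) auto
  then show ?thesis by (simp add: mean_0[OF x0 \<gamma>])
qed

text \<open>Here the inequality is required only for the action \<open>f x\<close>, and the stage
  cost carries the extra term \<open>l\<close>, whose discounted sum is split off at the
  end.\<close>

lemma le_stationary_cost:
  assumes f: "f \<in> borel_on X \<rightarrow>\<^sub>M borel_on U" and x0: "x0 \<in> X"
    and k: "\<And>u. u \<in> U \<Longrightarrow> (\<lambda>x. k x u) \<in> borel_measurable (borel_on X)"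
    and [measurable]: "h \<in> borel_measurable (borel_on X)" "l \<in> borel_measurable (borel_on X)"
    and bound: "\<And>x. x \<in> X \<Longrightarrow> h x \<le> ennreal D"
    and le: "\<And>x. x \<in> X \<Longrightarrow> h x \<le> (k x (f x) + l x) + ennreal \<beta> * (\<integral>\<^sup>+x'. h x' \<partial>T x (f x))"
  shows "h x0 \<le> (\<Sum>t. ennreal \<beta> ^ t * mean x0 (stationary f) t (\<lambda>p. k (fst p) (snd p)))
    + (\<Sum>t. ennreal \<beta> ^ t * mean x0 (stationary f) t (\<lambda>p. l (fst p)))"
proof -
  note \<gamma> = stationary_policy_admissible[OF f]
  note [measurable] = measurable_cost_to_go[OF k assms(4)] f
  let ?E = "mean x0 (stationary f)"
  have "?E t (\<lambda>p. h (fst p))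
      \<le> (?E t (\<lambda>p. k (fst p) (snd p)) + ?E t (\<lambda>p. l (fst p))) + ennreal \<beta> * ?E (Suc t) (\<lambda>p. h (fst p))" for t
  proof -
    let ?g = "\<lambda>p. (k (fst p) (snd p) + l (fst p)) + ennreal \<beta> * (\<integral>\<^sup>+x'. h x' \<partial>T (fst p) (snd p))"
    have "?E t (\<lambda>p. h (fst p)) \<le> ?E t (\<lambda>p. ?g (fst p, f (fst p)))"
      using le by (intro mean_mono[OF x0 \<gamma>]) simp
    also have "\<dots> = ?E t ?g"
      by (rule mean_stationary[OF f x0, symmetric]) measurable
    also have "\<dots> = (?E t (\<lambda>p. k (fst p) (snd p)) + ?E t (\<lambda>p. l (fst p))) + ennreal \<beta> * ?E (Suc t) (\<lambda>p. h (fst p))"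
      by (simp add: mean_Suc[OF x0 \<gamma>] mean_add[OF x0 \<gamma>] mean_cmult[OF x0 \<gamma>])
    finally show ?thesis .
  qed
  moreover have "?E t (\<lambda>p. h (fst p)) \<le> ennreal D" for t
    using bound by (intro mean_le[OF x0 \<gamma>]) simp
  ultimately have "?E 0 (\<lambda>p. h (fst p))
      \<le> (\<Sum>t. ennreal \<beta> ^ t * (?E t (\<lambda>p. k (fst p) (snd p)) + ?E t (\<lambda>p. l (fst p))))"
    using discount by (intro le_discounted_sum[of \<beta>]) auto
  then show ?thesis by (simp add: mean_0[OF x0 \<gamma>] distrib_left suminf_add)
qed

text \<open>Verification argument: for a bounded solution \<open>V\<close> of the Bellman equation,
  the greedy policy costs at most \<open>V\<close>, and every admissible policy costs at least
  \<open>V\<close>. One \<open>f\<close> serves all initial states.\<close>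

lemma optimal_stationary_policy:
  fixes k :: "'a \<Rightarrow> 'u \<Rightarrow> ennreal"
  assumes k: "\<And>u. u \<in> U \<Longrightarrow> (\<lambda>x. k x u) \<in> borel_measurable (borel_on X)"
    and bound: "0 \<le> D" "\<And>x u. x \<in> X \<Longrightarrow> u \<in> U \<Longrightarrow> k x u \<le> ennreal D"
  obtains f where "f \<in> borel_on X \<rightarrow>\<^sub>M borel_on U"
    "\<And>x0 \<gamma>. x0 \<in> X \<Longrightarrow> \<gamma> \<in> admissible_policies X U \<Longrightarrow>
      (\<Sum>t. ennreal \<beta> ^ t * mean x0 (stationary f) t (\<lambda>p. k (fst p) (snd p)))
      \<le> (\<Sum>t. ennreal \<beta> ^ t * mean x0 \<gamma> t (\<lambda>p. k (fst p) (snd p)))"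
proof -
  from bellman_solution[of k D, OF k bound] obtain V where V: "V \<in> borel_measurable (borel_on X)"
    "\<And>x. x \<in> X \<Longrightarrow> V x \<le> ennreal (D / (1 - \<beta>))"
    and V_eq: "\<And>x. x \<in> X \<Longrightarrow> V x = (INF u\<in>U. k x u + ennreal \<beta> * (\<integral>\<^sup>+x'. V x' \<partial>T x u))"
    by blast
  define Q where "Q u x = k x u + ennreal \<beta> * (\<integral>\<^sup>+x'. V x' \<partial>T x u)" for u x
  have Q: "Q u \<in> borel_measurable (borel_on X)" if "u \<in> U" for u
  proof -
    note [measurable] = k[OF that] measurable_nn_integral_T[OF V(1) that]
    show ?thesis unfolding Q_def by measurable
  qed
  obtain f where f: "f \<in> borel_on X \<rightarrow>\<^sub>M borel_on U" and f_eq: "\<And>x. Q (f x) x = (INF u\<in>U. Q u x)"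
    by (rule measurable_argmin_finite[OF finite_actions _ Q, where N="borel_on U"])
      (auto simp: space_restrict_space)
  have V_eq: "V x = (INF u\<in>U. Q u x)" if "x \<in> X" for x
    using V_eq[OF that] by (simp add: Q_def)
  show thesis
  proof (rule that[OF f])
    fix x0 \<gamma> assume x0: "x0 \<in> X" and \<gamma>: "\<gamma> \<in> admissible_policies X U"
    have "(\<Sum>t. ennreal \<beta> ^ t * mean x0 (stationary f) t (\<lambda>p. k (fst p) (snd p)))
        \<le> V x0 + (\<Sum>t. ennreal \<beta> ^ t * mean x0 (stationary f) t (\<lambda>p. 0))"
      by (rule stationary_cost_le[OF f x0 k V(1), where l="\<lambda>_. 0"]) (simp_all add: V_eq flip: f_eq Q_def)
    also have "\<dots> = V x0" by (simp add: mean_const[OF x0 stationary_policy_admissible[OF f]])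
    also have "\<dots> \<le> (\<Sum>t. ennreal \<beta> ^ t * mean x0 \<gamma> t (\<lambda>p. k (fst p) (snd p)))"
      by (rule le_policy_cost[OF \<gamma> x0 k V]) (auto simp: V_eq simp flip: Q_def intro: INF_lower)
    finally show "(\<Sum>t. ennreal \<beta> ^ t * mean x0 (stationary f) t (\<lambda>p. k (fst p) (snd p)))
      \<le> (\<Sum>t. ennreal \<beta> ^ t * mean x0 \<gamma> t (\<lambda>p. k (fst p) (snd p)))" .
  qed
qed

end

section \<open>Quantized state spaces\<close>

lemma l1_norm_nonneg: "0 \<le> l1_norm x"
  by (simp add: l1_norm_def sum_nonneg)

lemma borel_measurable_l1_norm [measurable]: "l1_norm \<in> borel_measurable borel"
  unfolding l1_norm_def[abs_def]
  by (intro borel_measurable_continuous_onI continuous_intros)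

text \<open>\<open>N\<close> stands for the supremum norm of the cost, and continuity of the cost
  appears as measurability in the state for each action.\<close>

locale quantized_mdp = finite_action_mdp X U T \<beta>
  for X :: "(real ^ 'n) set" and U :: "'u::t1_space set" and T \<beta> +
  fixes c :: "real ^ 'n \<Rightarrow> 'u \<Rightarrow> real" and N \<alpha>\<^sub>c \<alpha>\<^sub>T :: real
    and B :: "nat \<Rightarrow> (real ^ 'n) set" and M :: nat
    and y :: "nat \<Rightarrow> real ^ 'n" and \<pi> :: "(real ^ 'n) measure"
  assumes c_meas: "\<And>u. u \<in> U \<Longrightarrow> (\<lambda>x. c x u) \<in> borel_measurable (borel_on X)"
    and c_nonneg: "\<And>x u. x \<in> X \<Longrightarrow> u \<in> U \<Longrightarrow> 0 \<le> c x u"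
    and c_le: "\<And>x u. x \<in> X \<Longrightarrow> u \<in> U \<Longrightarrow> c x u \<le> N"
    and constants: "0 < \<alpha>\<^sub>c" "0 < \<alpha>\<^sub>T" "0 \<le> N"
    and c_lipschitz: "\<And>x x' u. x \<in> X \<Longrightarrow> x' \<in> X \<Longrightarrow> u \<in> U \<Longrightarrow>
      \<bar>c x u - c x' u\<bar> \<le> \<alpha>\<^sub>c * l1_norm (x - x')"
    and T_lipschitz: "\<And>x x' u. x \<in> X \<Longrightarrow> x' \<in> X \<Longrightarrow> u \<in> U \<Longrightarrow>
      tv_dist (T x u) (T x' u) \<le> \<alpha>\<^sub>T * l1_norm (x - x')"
    and bins: "\<And>i. i \<in> {1..M} \<Longrightarrow> B i \<in> sets (borel_on X)"
      "disjoint_family_on B {1..M}" "(\<Union>i\<in>{1..M}. B i) = X"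
    and representatives: "\<And>i. i \<in> {1..M} \<Longrightarrow> y i \<in> B i"
    and \<pi>: "prob_space \<pi>" "sets \<pi> = sets (borel_on X)"
      "\<And>i. i \<in> {1..M} \<Longrightarrow> 0 < measure \<pi> (B i)"
begin

section \<open>Bins and representatives\<close>

abbreviation "idx \<equiv> bin_index B M"
abbreviation "Y \<equiv> finite_states M y"
abbreviation "qt \<equiv> quantizer B M y"
abbreviation "w \<equiv> weighting B M \<pi>"

lemma idx_eq:
  assumes "i \<in> {1..M}" "x \<in> B i"
  shows "idx x = i"
  unfolding bin_index_def
proof (rule the_equality)
  fix i' assume "i' \<in> {1..M} \<and> x \<in> B i'"
  with assms show "i' = i" using disjoint_family_onD[OF bins(2), of i i'] by auto
qed (use assms in simp)

lemma idx: assumes "x \<in> X" shows "idx x \<in> {1..M}" "x \<in> B (idx x)"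
proof -
  obtain i where "i \<in> {1..M}" "x \<in> B i" using assms bins(3) by blast
  then show "idx x \<in> {1..M}" "x \<in> B (idx x)" using idx_eq[of i x] by auto
qed

lemma bin_sub: "i \<in> {1..M} \<Longrightarrow> B i \<subseteq> X"
  using bins(3) by blast

lemma representative_in: "i \<in> {1..M} \<Longrightarrow> y i \<in> X"
  using bin_sub representatives by blast

lemma idx_y: "i \<in> {1..M} \<Longrightarrow> idx (y i) = i"
  by (rule idx_eq[OF _ representatives])

lemma finite_Y: "finite Y" and Y_sub: "Y \<subseteq> X"
  using representative_in by (auto simp: finite_states_def)

lemma idx_quantizer: "x \<in> X \<Longrightarrow> idx (qt x) = idx x"
  by (simp only: quantizer_def idx_y[OF idx(1)])

lemma quantizer_in: "x \<in> X \<Longrightarrow> qt x \<in> Y"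
  using idx(1) by (auto simp: quantizer_def finite_states_def)

lemma bin_sets: "x \<in> X \<Longrightarrow> bin B M x \<in> sets (borel_on X)"
  unfolding bin_def by (intro bins idx)

lemma mem_bin_iff: assumes "z \<in> Y" "x \<in> X" shows "x \<in> bin B M z \<longleftrightarrow> z = qt x"
proof -
  obtain i where i: "i \<in> {1..M}" "z = y i" using assms(1) by (auto simp: finite_states_def)
  have "x \<in> B i \<longleftrightarrow> idx x = i" using idx[OF assms(2)] idx_eq[OF i(1), of x] by auto
  moreover have "z = qt x \<longleftrightarrow> idx x = i"
    using i(2) idx_y[OF i(1)] idx_y[OF idx(1)[OF assms(2)]] unfolding quantizer_def by metis
  ultimately show ?thesis by (simp add: bin_def i(2) idx_y[OF i(1)])
qed

lemma measurable_idx: "idx \<in> borel_on X \<rightarrow>\<^sub>M count_space {1..M}"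
proof (subst measurable_count_space_eq_countable)
  have "idx -` {i} \<inter> X = B i" if "i \<in> {1..M}" for i
    using idx_eq[OF that] idx bin_sub[OF that] by auto
  then show "idx \<in> space (borel_on X) \<rightarrow> {1..M} \<and> (\<forall>i\<in>{1..M}. idx -` {i} \<inter> space (borel_on X) \<in> sets (borel_on X))"
    using idx bins(1) by (auto simp: space_restrict_space)
qed simp

text \<open>The bin index takes values in a finite discrete space, so anything depending on the
  state only through its bin is measurable, with no condition on \<open>G\<close>.\<close>

lemma measurable_binwise: "(\<lambda>x. G (idx x) :: 'z::topological_space) \<in> borel_measurable (borel_on X)"
  by (rule measurable_compose[OF measurable_idx]) simp

section \<open>Averaging over a bin\<close>

lemma sets_w: "sets (w x) = sets (borel_on X)" and space_w: "space (w x) = X"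
  using \<pi>(2) sets_eq_imp_space_eq[OF \<pi>(2)] by (auto simp: weighting_def space_restrict_space)

lemma prob_space_w: "x \<in> X \<Longrightarrow> prob_space (w x)"
proof -
  assume "x \<in> X"
  interpret prob_space \<pi> by (rule \<pi>)
  show ?thesis
    unfolding weighting_def
    using \<pi>(3)[OF idx(1)[OF \<open>x \<in> X\<close>]]
    by (intro prob_space_uniform_measure) (auto simp: bin_def emeasure_eq_measure)
qed

lemma AE_w: "x \<in> X \<Longrightarrow> AE x' in w x. x' \<in> bin B M x"
  unfolding weighting_def by (rule AE_uniform_measureI) (use bin_sets \<pi>(2) in auto)

lemma borel_measurable_w:
  "g \<in> borel_measurable (borel_on X) \<Longrightarrow> g \<in> borel_measurable (w x)"
  by (simp add: measurable_cong_sets[OF sets_w refl])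

lemma set_integral_w:
  fixes g :: "real ^ 'n \<Rightarrow> real"
  assumes x: "x \<in> X" and [measurable]: "g \<in> borel_measurable (borel_on X)"
  shows "(LINT x':bin B M x|w x. g x') = (LINT x'|w x. g x')"
  unfolding set_lebesgue_integral_def
proof (rule integral_cong_AE)
  note [measurable] = borel_measurable_w[OF assms(2)]
  have [measurable]: "bin B M x \<in> sets (w x)" using bin_sets[OF x] by (simp add: sets_w)
  show "(\<lambda>x'. indicator (bin B M x) x' *\<^sub>R g x') \<in> borel_measurable (w x)" by measurable
  show "AE x' in w x. indicator (bin B M x) x' *\<^sub>R g x' = g x'"
    using AE_w[OF x] by eventually_elim simp
qed (rule borel_measurable_w[OF assms(2)])

lemma finite_cost_eq: "x \<in> X \<Longrightarrow> u \<in> U \<Longrightarrow> finite_cost B M \<pi> c x u = (LINT x'|w x. c x' u)"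
  unfolding finite_cost_def by (intro set_integral_w c_meas)

lemma integral_quantized:
  fixes J :: "real ^ 'n \<Rightarrow> real"
  assumes x: "x \<in> X" and u: "u \<in> U"
  shows "(LINT x'|T x u. J (qt x')) = (\<Sum>z\<in>Y. J z * measure (T x u) (bin B M z))"
proof -
  interpret prob_space "T x u" by (rule T_prob[OF x u])
  have m: "bin B M z \<in> sets (T x u)" if "z \<in> Y" for z
    using that bin_sets Y_sub by (auto simp: sets_T[OF x u])
  have "(LINT x'|T x u. J (qt x')) = (LINT x'|T x u. (\<Sum>z\<in>Y. J z * indicator (bin B M z) x'))"
  proof (rule Bochner_Integration.integral_cong[OF refl])
    fix x' assume "x' \<in> space (T x u)"
    then have x': "x' \<in> X" by (simp add: space_T[OF x u])
    have "(\<Sum>z\<in>Y. J z * indicator (bin B M z) x') = (\<Sum>z\<in>Y. if z = qt x' then J z else 0)"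
      by (intro sum.cong refl) (simp add: mem_bin_iff x' indicator_def)
    also have "\<dots> = J (qt x')" using finite_Y quantizer_in[OF x'] by simp
    finally show "J (qt x') = (\<Sum>z\<in>Y. J z * indicator (bin B M z) x')" ..
  qed
  also have "\<dots> = (\<Sum>z\<in>Y. LINT x'|T x u. J z * indicator (bin B M z) x')"
    using m by (intro Bochner_Integration.integral_sum integrable_mult_right integrable_real_indicator) (auto simp: emeasure_eq_measure)
  also have "\<dots> = (\<Sum>z\<in>Y. J z * measure (T x u) (bin B M z))"
    using m by (intro sum.cong refl) simp
  finally show ?thesis .
qed

lemma measurable_measure_T:
  "z \<in> Y \<Longrightarrow> u \<in> U \<Longrightarrow> (\<lambda>x. measure (T x u) (bin B M z)) \<in> borel_measurable (borel_on X)"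
  by (rule measurable_compose[OF measurable_T measurable_measure_subprob_algebra])
    (use bin_sets Y_sub in auto)

text \<open>The link between the two models: exchanging the finite sum with the bin average shows
  that the expected next value in the finite model is the bin average of the true expected next
  value of \<open>J\<close> extended through the quantizer.\<close>

lemma finite_kernel_sum:
  assumes x: "x \<in> X" and u: "u \<in> U"
  shows "(\<Sum>z\<in>Y. J z * finite_kernel B M \<pi> T z x u) = (LINT x'|w x. LINT x''|T x' u. J (qt x''))"
proof -
  interpret prob_space "w x" by (rule prob_space_w[OF x])
  have int: "integrable (w x) (\<lambda>x'. measure (T x' u) (bin B M z))" if "z \<in> Y" for z
    by (rule integrable_abs_le[OF borel_measurable_w[OF measurable_measure_T[OF that u]], of 1])
      (auto simp: space_w prob_space.prob_le_1[OF T_prob] u)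
  have "(\<Sum>z\<in>Y. J z * finite_kernel B M \<pi> T z x u) = (\<Sum>z\<in>Y. LINT x'|w x. J z * measure (T x' u) (bin B M z))"
    unfolding finite_kernel_def
    by (intro sum.cong refl) (simp add: set_integral_w[OF x measurable_measure_T] u)
  also have "\<dots> = (LINT x'|w x. (\<Sum>z\<in>Y. J z * measure (T x' u) (bin B M z)))"
    using int by (intro Bochner_Integration.integral_sum[symmetric]) auto
  also have "\<dots> = (LINT x'|w x. LINT x''|T x' u. J (qt x''))"
    by (intro Bochner_Integration.integral_cong refl) (simp add: integral_quantized space_w u)
  finally show ?thesis .
qed

lemma finite_kernel_nonneg: "0 \<le> finite_kernel B M \<pi> T z x u"
  unfolding finite_kernel_def set_lebesgue_integral_def by (intro Bochner_Integration.integral_nonneg) auto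

sublocale bellman: finite_state_bellman Y U "finite_cost B M \<pi> c" "finite_kernel B M \<pi> T" \<beta> N
proof
  fix v u assume v: "v \<in> Y" and u: "u \<in> U"
  then have x: "v \<in> X" using Y_sub by auto
  interpret prob_space "w v" by (rule prob_space_w[OF x])
  \<comment> \<open>With \<open>J = 1\<close> the link between the models says that the averaged
    kernel is stochastic.\<close>
  have "(\<Sum>z\<in>Y. 1 * finite_kernel B M \<pi> T z v u) = (LINT x'|w v. LINT x''|T x' u. 1)"
    by (rule finite_kernel_sum[OF x u, of "\<lambda>_. 1"])
  also have "\<dots> = (LINT x'|w v. 1)"
    by (intro Bochner_Integration.integral_cong refl) (simp add: space_w prob_space.prob_space[OF T_prob] u)
  finally show "(\<Sum>z\<in>Y. finite_kernel B M \<pi> T z v u) = 1" by (simp add: prob_space)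
  have "AE x' in w v. 0 \<le> c x' u" "AE x' in w v. c x' u \<le> N"
    by (auto intro!: AE_I2 c_nonneg c_le u simp: space_w)
  moreover have "integrable (w v) (\<lambda>x'. c x' u)"
    by (rule integrable_abs_le[OF borel_measurable_w[OF c_meas[OF u]], of N])
      (simp add: space_w c_nonneg c_le u)
  ultimately show "0 \<le> finite_cost B M \<pi> c v u" "finite_cost B M \<pi> c v u \<le> N"
    unfolding finite_cost_eq[OF x u] by (auto intro: integral_nonneg_AE integral_le_const)
qed (use finite_Y finite_actions discount finite_kernel_nonneg in auto)

section \<open>The finite value function and its one-step action values\<close>

abbreviation "Jhat \<equiv> approx_value U T c \<beta> B M y \<pi>"

text \<open>Uniqueness identifies the definite description with the limit of value iteration, whose
  bounds it thereby inherits.\<close>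

lemma finite_value:
  assumes "v \<in> Y"
  shows "finite_value U T c \<beta> B M y \<pi> v = bellman.bellman (finite_value U T c \<beta> B M y \<pi>) v"
    and "0 \<le> finite_value U T c \<beta> B M y \<pi> v" "finite_value U T c \<beta> B M y \<pi> v \<le> N / (1 - \<beta>)"
proof -
  obtain J where J: "J \<in> extensional Y" "\<forall>v\<in>Y. J v = bellman.bellman J v"
    "\<forall>v\<in>Y. 0 \<le> J v \<and> J v \<le> N / (1 - \<beta>)"
    using bellman.ex_bellman_fixed_point by blast
  have "finite_value U T c \<beta> B M y \<pi> = (THE J. J \<in> extensional Y \<and> (\<forall>v\<in>Y. J v = bellman.bellman J v))"
    unfolding finite_value_def bellman.bellman_def ..
  also have "\<dots> = J"
    using bellman.ex1_bellman_fixed_point J by (intro the1_equality) auto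
  finally show "finite_value U T c \<beta> B M y \<pi> v = bellman.bellman (finite_value U T c \<beta> B M y \<pi>) v"
    "0 \<le> finite_value U T c \<beta> B M y \<pi> v" "finite_value U T c \<beta> B M y \<pi> v \<le> N / (1 - \<beta>)"
    using J assms by auto
qed

lemma approx_value_bounds:
  "x \<in> X \<Longrightarrow> 0 \<le> Jhat x" "x \<in> X \<Longrightarrow> Jhat x \<le> N / (1 - \<beta>)" "x \<in> X \<Longrightarrow> \<bar>Jhat x\<bar> \<le> N / (1 - \<beta>)"
  using finite_value(2,3)[OF quantizer_in, of x] by (auto simp: approx_value_def)

lemma approx_value_meas: "Jhat \<in> borel_measurable (borel_on X)"
  unfolding approx_value_def[abs_def] quantizer_def by (rule measurable_binwise)

text \<open>The function \<open>Q\<close> of the opening outline; \<open>averaged_value\<close> is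
  \<open>Q'\<close>.\<close>

definition action_value :: "real ^ 'n \<Rightarrow> 'u \<Rightarrow> real" where
  "action_value x u = c x u + \<beta> * (LINT x'|T x u. Jhat x')"

definition averaged_value :: "real ^ 'n \<Rightarrow> 'u \<Rightarrow> real" where
  "averaged_value x u = (LINT x'|w x. action_value x' u)"

lemma integral_Jhat_meas: "u \<in> U \<Longrightarrow> (\<lambda>x. LINT x'|T x u. Jhat x') \<in> borel_measurable (borel_on X)"
  by (rule measurable_compose[OF measurable_T integral_measurable_subprob_algebra[OF approx_value_meas]])

lemma action_value_meas: "u \<in> U \<Longrightarrow> (\<lambda>x. action_value x u) \<in> borel_measurable (borel_on X)"
proof -
  assume "u \<in> U"
  note [measurable] = c_meas[OF this] integral_Jhat_meas[OF this]
  show ?thesis unfolding action_value_def by measurable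
qed

lemma abs_integral_Jhat_le: "x \<in> X \<Longrightarrow> u \<in> U \<Longrightarrow> \<bar>LINT x'|T x u. Jhat x'\<bar> \<le> N / (1 - \<beta>)"
  by (intro prob_space.abs_expectation_le T_prob borel_measurable_T approx_value_meas approx_value_bounds)
    (auto simp: space_T)

text \<open>A state and its representative share a bin and hence a weighting measure; the rest is
  linearity and \<open>finite_kernel_sum\<close>. The right-hand side is the term minimized in the
  finite Bellman equation.\<close>

lemma averaged_value_eq:
  assumes x: "x \<in> X" and u: "u \<in> U"
  shows "averaged_value x u = finite_cost B M \<pi> c (qt x) u
    + \<beta> * (\<Sum>z\<in>Y. finite_value U T c \<beta> B M y \<pi> z * finite_kernel B M \<pi> T z (qt x) u)"
proof -
  interpret prob_space "w x" by (rule prob_space_w[OF x])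
  have bin: "bin B M (qt x) = bin B M x" by (simp add: bin_def idx_quantizer x)
  then have w: "w (qt x) = w x" by (simp add: weighting_def)
  have fc: "finite_cost B M \<pi> c (qt x) u = finite_cost B M \<pi> c x u"
    and fk: "finite_kernel B M \<pi> T z (qt x) u = finite_kernel B M \<pi> T z x u" for z
    by (simp_all add: finite_cost_def finite_kernel_def bin w)
  have "integrable (w x) (\<lambda>x'. c x' u)"
    by (rule integrable_abs_le[OF borel_measurable_w[OF c_meas[OF u]], of N])
      (simp add: space_w c_nonneg c_le u)
  moreover have "integrable (w x) (\<lambda>x'. LINT x''|T x' u. Jhat x'')"
    by (rule integrable_abs_le[OF borel_measurable_w[OF integral_Jhat_meas[OF u]], of "N / (1 - \<beta>)"])
      (simp add: space_w abs_integral_Jhat_le u)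
  ultimately have "averaged_value x u = (LINT x'|w x. c x' u) + \<beta> * (LINT x'|w x. LINT x''|T x' u. Jhat x'')"
    unfolding averaged_value_def action_value_def by simp
  then show ?thesis
    unfolding fc fk finite_cost_eq[OF x u] finite_kernel_sum[OF x u] approx_value_def .
qed

lemma approx_value_eq: "x \<in> X \<Longrightarrow> Jhat x = (INF u\<in>U. averaged_value x u)"
  using finite_value(1)[OF quantizer_in, of x]
  by (simp add: approx_value_def bellman.bellman_def averaged_value_eq)

definition lip_const :: real where
  "lip_const = \<alpha>\<^sub>c + \<beta> * \<alpha>\<^sub>T * N / (1 - \<beta>)"

lemma lip_const_pos: "0 < lip_const"
  using constants discount unfolding lip_const_def by (intro add_pos_nonneg divide_nonneg_pos mult_nonneg_nonneg) auto

text \<open>The cost contributes \<open>\<alpha>\<^sub>c\<close>. The continuation value changes by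
  at most its bound \<open>N / (1 - \<beta>)\<close> times the total variation distance of the
  kernels, and is discounted by \<open>\<beta>\<close>.\<close>

lemma action_value_lipschitz:
  assumes "x \<in> X" "x' \<in> X" "u \<in> U"
  shows "\<bar>action_value x' u - action_value x u\<bar> \<le> lip_const * l1_norm (x - x')"
proof -
  have "\<bar>(LINT z|T x u. Jhat z) - (LINT z|T x' u. Jhat z)\<bar> \<le> N / (1 - \<beta>) * tv_dist (T x u) (T x' u)"
    using assms
    by (intro abs_integral_diff_le_tv_dist T_prob borel_measurable_T approx_value_meas approx_value_bounds)
      (auto simp: space_T sets_T)
  also have "\<dots> \<le> N / (1 - \<beta>) * (\<alpha>\<^sub>T * l1_norm (x - x'))"
    using constants discount by (intro mult_left_mono T_lipschitz assms) auto
  finally have "\<beta> * \<bar>(LINT z|T x u. Jhat z) - (LINT z|T x' u. Jhat z)\<bar> \<le> \<beta> * (N / (1 - \<beta>) * (\<alpha>\<^sub>T * l1_norm (x - x')))"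
    using discount by (intro mult_left_mono) auto
  moreover have "\<bar>action_value x' u - action_value x u\<bar> \<le> \<bar>c x u - c x' u\<bar> + \<beta> * \<bar>(LINT z|T x u. Jhat z) - (LINT z|T x' u. Jhat z)\<bar>"
  proof -
    have "\<bar>\<beta> * ((LINT z|T x u. Jhat z) - (LINT z|T x' u. Jhat z))\<bar> = \<beta> * \<bar>(LINT z|T x u. Jhat z) - (LINT z|T x' u. Jhat z)\<bar>"
      using discount by (simp add: abs_mult)
    then show ?thesis unfolding action_value_def right_diff_distrib by linarith
  qed
  moreover note c_lipschitz[OF assms]
  moreover have "lip_const * l1_norm (x - x') = \<alpha>\<^sub>c * l1_norm (x - x') + \<beta> * (N / (1 - \<beta>) * (\<alpha>\<^sub>T * l1_norm (x - x')))"
    using discount by (simp add: lip_const_def field_simps)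
  ultimately show ?thesis by linarith
qed

section \<open>The quantization loss\<close>

abbreviation "loss \<equiv> quantization_loss B M \<pi>"

text \<open>The measure in the loss varies with \<open>x\<close>, but only through the bin. For a
  fixed bin the integral is measurable in \<open>x\<close> as a parameter integral, and the finitely
  many versions are glued along \<open>idx\<close>.\<close>

lemma loss_meas: "loss \<in> borel_measurable (borel_on X)"
proof -
  interpret prob_space \<pi> by (rule \<pi>)
  have "(\<lambda>x. \<integral>\<^sup>+x'. ennreal (l1_norm (x - x')) * indicator (B i) x' \<partial>uniform_measure \<pi> (B i)) \<in> borel_measurable (borel_on X)"
    if i: "i \<in> {1..M}" for i
  proof -
    interpret u: prob_space "uniform_measure \<pi> (B i)"
      using \<pi>(3)[OF i] by (intro prob_space_uniform_measure) (auto simp: emeasure_eq_measure)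
    have s: "sets (uniform_measure \<pi> (B i)) = sets (borel_on X)" using \<pi>(2) by simp
    have [measurable]: "B i \<in> sets (uniform_measure \<pi> (B i))" using bins(1)[OF i] s by simp
    have [measurable]: "fst \<in> borel_on X \<Otimes>\<^sub>M uniform_measure \<pi> (B i) \<rightarrow>\<^sub>M borel"
      "snd \<in> borel_on X \<Otimes>\<^sub>M uniform_measure \<pi> (B i) \<rightarrow>\<^sub>M borel"
      by (auto intro!: measurable_compose[OF measurable_fst] measurable_compose[OF measurable_snd]
          measurable_restrict_space1 simp: measurable_cong_sets[OF s refl])
    have "(\<lambda>p. ennreal (l1_norm (fst p - snd p)) * indicator (B i) (snd p)) \<in> borel_measurable (borel_on X \<Otimes>\<^sub>M uniform_measure \<pi> (B i))"
      by measurable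
    then show ?thesis
      by (intro u.borel_measurable_nn_integral) (simp add: case_prod_beta)
  qed
  from measurable_compose_countable'[of "{1..M}", OF this measurable_idx]
  show ?thesis
    by (simp add: quantization_loss_def[abs_def] weighting_def bin_def)
qed

text \<open>The difference is the bin average of
  \<open>action_value x' u - action_value x u\<close>; move the absolute value inside and apply the
  Lipschitz bound. The weighting measure sees only the bin, so the indicator in the loss is 1 almost
  everywhere.\<close>

lemma abs_averaged_value_diff_le:
  assumes x: "x \<in> X" and u: "u \<in> U"
  shows "ennreal \<bar>averaged_value x u - action_value x u\<bar> \<le> ennreal lip_const * loss x"
proof -
  interpret prob_space "w x" by (rule prob_space_w[OF x])
  note [measurable] = borel_measurable_w[OF action_value_meas[OF u]]
  have [measurable]: "bin B M x \<in> sets (w x)" using bin_sets[OF x] by (simp add: sets_w)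
  have [measurable]: "(\<lambda>x'. x') \<in> w x \<rightarrow>\<^sub>M borel"
    unfolding measurable_cong_sets[OF sets_w refl] by (rule measurable_restrict_space1) simp
  have "\<bar>action_value x' u\<bar> \<le> N + \<beta> * (N / (1 - \<beta>))" if "x' \<in> X" for x'
  proof -
    have "\<bar>\<beta> * (LINT x''|T x' u. Jhat x'')\<bar> \<le> \<beta> * (N / (1 - \<beta>))"
      using mult_left_mono[OF abs_integral_Jhat_le[OF that u], of \<beta>] discount by (simp add: abs_mult)
    then show ?thesis unfolding action_value_def using c_nonneg[OF that u] c_le[OF that u] by linarith
  qed
  then have int: "integrable (w x) (\<lambda>x'. action_value x' u)"
    by (intro integrable_abs_le) (auto simp: space_w)
  then have "averaged_value x u - action_value x u = (LINT x'|w x. action_value x' u - action_value x u)"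
    unfolding averaged_value_def by (simp add: prob_space)
  also have "ennreal \<bar>\<dots>\<bar> \<le> (\<integral>\<^sup>+x'. ennreal \<bar>action_value x' u - action_value x u\<bar> \<partial>w x)"
    using integral_norm_bound_ennreal[of "w x" "\<lambda>x'. action_value x' u - action_value x u"] int by simp
  also have "\<dots> \<le> (\<integral>\<^sup>+x'. ennreal lip_const * (ennreal (l1_norm (x - x')) * indicator (bin B M x) x') \<partial>w x)"
  proof (rule nn_integral_mono_AE)
    show "AE x' in w x. ennreal \<bar>action_value x' u - action_value x u\<bar> \<le> ennreal lip_const * (ennreal (l1_norm (x - x')) * indicator (bin B M x) x')"
      using AE_w[OF x] AE_space
    proof eventually_elim
      case (elim x')
      then show ?case
        using action_value_lipschitz[OF x _ u, of x'] lip_const_pos l1_norm_nonneg[of "x - x'"]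
        by (simp add: space_w ennreal_leI flip: ennreal_mult)
    qed
  qed
  also have "\<dots> = ennreal lip_const * loss x"
    unfolding quantization_loss_def by (rule nn_integral_cmult) measurable
  finally show ?thesis .
qed

lemma ennreal_action_value:
  assumes x: "x \<in> X" and u: "u \<in> U"
  shows "ennreal (action_value x u) = ennreal (c x u) + ennreal \<beta> * (\<integral>\<^sup>+x'. ennreal (Jhat x') \<partial>T x u)"
proof -
  interpret prob_space "T x u" by (rule T_prob[OF x u])
  have int: "integrable (T x u) Jhat"
    by (rule integrable_abs_le[OF borel_measurable_T[OF approx_value_meas x u], of "N / (1 - \<beta>)"])
      (simp add: space_T x u approx_value_bounds)
  have AE: "AE x' in T x u. 0 \<le> Jhat x'"
    by (intro AE_I2) (simp add: space_T x u approx_value_bounds)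
  then have "0 \<le> (LINT x'|T x u. Jhat x')" by (rule integral_nonneg_AE)
  then show ?thesis
    using c_nonneg[OF x u] discount
    by (simp add: action_value_def nn_integral_eq_integral[OF int AE] ennreal_mult)
qed

text \<open>The factor \<open>1 / (1 - \<beta>)\<close> of the final bound appears here: it undoes
  the normalization of the occupation measure.\<close>

lemma discounted_loss_eq:
  assumes f: "f \<in> borel_on X \<rightarrow>\<^sub>M borel_on U" and x0: "x0 \<in> X"
  shows "(\<Sum>t. ennreal \<beta> ^ t * mean x0 (stationary f) t (\<lambda>p. ennreal lip_const * loss (fst p)))
    = ennreal (lip_const * (1 / (1 - \<beta>))) * (\<integral>\<^sup>+x. loss x \<partial>occupation_measure X U T \<beta> x0 (stationary f))"
proof -
  note \<gamma> = stationary_policy_admissible[OF f]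
  note [measurable] = loss_meas
  let ?s = "\<Sum>t. ennreal \<beta> ^ t * mean x0 (stationary f) t (\<lambda>p. loss (fst p))"
  have "(\<Sum>t. ennreal \<beta> ^ t * mean x0 (stationary f) t (\<lambda>p. ennreal lip_const * loss (fst p)))
      = (\<Sum>t. ennreal lip_const * (ennreal \<beta> ^ t * mean x0 (stationary f) t (\<lambda>p. loss (fst p))))"
    by (simp add: mean_cmult[OF x0 \<gamma>] mult.left_commute)
  also have "\<dots> = ennreal lip_const * ?s"
    by (rule ennreal_suminf_cmult)
  also have "\<dots> = ennreal (lip_const * (1 / (1 - \<beta>)) * (1 - \<beta>)) * ?s"
    using discount by simp
  also have "\<dots> = ennreal (lip_const * (1 / (1 - \<beta>))) * (ennreal (1 - \<beta>) * ?s)"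
    using discount lip_const_pos by (subst ennreal_mult) (auto simp: mult.assoc)
  finally show ?thesis
    by (simp only: nn_integral_occupation_measure[OF x0 \<gamma> loss_meas])
qed

section \<open>The two-sided comparison\<close>

theorem approx_value_error:
  assumes x0: "x0 \<in> X"
  shows "ennreal \<bar>Jhat x0 - optimal_cost X U T c \<beta> x0\<bar> \<le> ennreal (lip_const * (1 / (1 - \<beta>)))
      * (SUP \<gamma>\<in>stationary_policies X U. \<integral>\<^sup>+x. loss x \<partial>occupation_measure X U T \<beta> x0 \<gamma>)"
    (is "_ \<le> ?R")
proof -
  define k where "k x u = ennreal (c x u)" for x u
  define h where "h x = ennreal (Jhat x)" for x
  define l where "l x = ennreal lip_const * loss x" for x
  have k: "(\<lambda>x. k x u) \<in> borel_measurable (borel_on X)" if "u \<in> U" for u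
    unfolding k_def using c_meas[OF that] by measurable
  have h: "h \<in> borel_measurable (borel_on X)"
    unfolding h_def[abs_def] using approx_value_meas by measurable
  have l: "l \<in> borel_measurable (borel_on X)"
    unfolding l_def[abs_def] using loss_meas by measurable
  have q_eq: "ennreal (action_value x u) = k x u + ennreal \<beta> * (\<integral>\<^sup>+x'. h x' \<partial>T x u)" if "x \<in> X" "u \<in> U" for x u
    unfolding k_def h_def by (rule ennreal_action_value[OF that])
  \<comment> \<open>\<open>ennreal\<close> sends negative numbers to 0, so \<open>max b 0\<close>
    replaces \<open>b\<close> before the sum is split.\<close>
  have le: "ennreal a \<le> ennreal b + ennreal \<bar>d\<bar>" if "a \<le> b + \<bar>d\<bar>" for a b d :: real
  proof -
    have "ennreal a \<le> ennreal (max b 0 + \<bar>d\<bar>)" using that by (intro ennreal_leI) auto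
    then show ?thesis by (simp add: ennreal_plus)
  qed
  have loss_le: "(\<Sum>t. ennreal \<beta> ^ t * mean x0 (stationary f) t (\<lambda>p. l (fst p))) \<le> ?R"
    if f: "f \<in> borel_on X \<rightarrow>\<^sub>M borel_on U" for f
    unfolding l_def discounted_loss_eq[OF f x0]
    by (intro mult_left_mono SUP_upper stationary_in f) simp
  have c_S: "(\<lambda>(x, u). c x u) \<in> borel_measurable S"
    using measurable_actionwise[of "\<lambda>u x. c x u", OF c_meas] by (simp add: case_prod_beta)
  have cost_nonneg: "0 \<le> discounted_cost X U T c \<beta> x0 \<gamma>"
    and cost_eq: "ennreal (discounted_cost X U T c \<beta> x0 \<gamma>)
      = (\<Sum>t. ennreal \<beta> ^ t * mean x0 \<gamma> t (\<lambda>p. k (fst p) (snd p)))"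
    if \<gamma>: "\<gamma> \<in> admissible_policies X U" for \<gamma>
    unfolding k_def
    using discounted_cost_nonneg[OF x0 \<gamma> c_S] discounted_cost_eq[OF x0 \<gamma> c_S] c_nonneg c_le by blast+
  \<comment> \<open>The supremum in \<open>?R\<close> controls the loss only along stationary
    policies, so an arbitrary \<open>\<gamma>\<close> is reached through a stationary policy that
    costs no more.\<close>
  obtain f where f: "f \<in> borel_on X \<rightarrow>\<^sub>M borel_on U"
    and f_opt: "\<And>\<gamma>. \<gamma> \<in> admissible_policies X U \<Longrightarrow>
      (\<Sum>t. ennreal \<beta> ^ t * mean x0 (stationary f) t (\<lambda>p. k (fst p) (snd p)))
      \<le> (\<Sum>t. ennreal \<beta> ^ t * mean x0 \<gamma> t (\<lambda>p. k (fst p) (snd p)))"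
  proof (rule optimal_stationary_policy[of k N, OF k])
    show "k x u \<le> ennreal N" if "x \<in> X" "u \<in> U" for x u
      unfolding k_def by (intro ennreal_leI c_le that)
  qed (use constants x0 in auto)
  have upper: "h x0 \<le> ennreal (discounted_cost X U T c \<beta> x0 \<gamma>) + ?R"
    if \<gamma>: "\<gamma> \<in> admissible_policies X U" for \<gamma>
  proof -
    have "h x0 \<le> (\<Sum>t. ennreal \<beta> ^ t * mean x0 (stationary f) t (\<lambda>p. k (fst p) (snd p)))
        + (\<Sum>t. ennreal \<beta> ^ t * mean x0 (stationary f) t (\<lambda>p. l (fst p)))"
    proof (rule le_stationary_cost[OF f x0 k h l])
      fix x assume x: "x \<in> X"
      note u = policy_actions_in[OF f x]
      show "h x \<le> ennreal (N / (1 - \<beta>))"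
        unfolding h_def by (intro ennreal_leI approx_value_bounds x)
      have "Jhat x \<le> averaged_value x (f x)"
        unfolding approx_value_eq[OF x] by (intro INF_lower_finite finite_actions u)
      then have "h x \<le> ennreal (action_value x (f x)) + ennreal \<bar>averaged_value x (f x) - action_value x (f x)\<bar>"
        unfolding h_def by (intro le) linarith
      also have "\<dots> \<le> ennreal (action_value x (f x)) + l x"
        unfolding l_def by (intro add_left_mono abs_averaged_value_diff_le x u)
      finally show "h x \<le> (k x (f x) + l x) + ennreal \<beta> * (\<integral>\<^sup>+x'. h x' \<partial>T x (f x))"
        unfolding q_eq[OF x u] by (simp add: ac_simps)
    qed
    also have "\<dots> \<le> ennreal (discounted_cost X U T c \<beta> x0 \<gamma>) + ?R"
      unfolding cost_eq[OF \<gamma>] by (intro add_mono f_opt \<gamma> loss_le f)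
    finally show ?thesis .
  qed

  \<comment> \<open>An optimal policy of the finite model, used in the original one. The selection
    is measurable because averaged values depend on the state only through its bin.\<close>
  obtain g where g: "g \<in> borel_on X \<rightarrow>\<^sub>M borel_on U" and g_min: "\<And>x. averaged_value x (g x) = (INF u\<in>U. averaged_value x u)"
  proof (rule measurable_argmin_finite[OF finite_actions, of "borel_on U" "\<lambda>u x. averaged_value x u" "borel_on X"])
    show "(\<lambda>x. averaged_value x u) \<in> borel_measurable (borel_on X)" for u
      unfolding averaged_value_def weighting_def bin_def by (rule measurable_binwise)
  qed (auto simp: space_restrict_space)
  have lower: "ennreal (discounted_cost X U T c \<beta> x0 (stationary g)) \<le> h x0 + ?R"
  proof -
    have "ennreal (discounted_cost X U T c \<beta> x0 (stationary g))
        \<le> h x0 + (\<Sum>t. ennreal \<beta> ^ t * mean x0 (stationary g) t (\<lambda>p. l (fst p)))"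
      unfolding cost_eq[OF stationary_policy_admissible[OF g]]
    proof (rule stationary_cost_le[OF g x0 k h l])
      fix x assume x: "x \<in> X"
      note u = policy_actions_in[OF g x]
      have "Jhat x = averaged_value x (g x)" by (simp add: approx_value_eq x g_min)
      then have "ennreal (action_value x (g x)) \<le> h x + ennreal \<bar>averaged_value x (g x) - action_value x (g x)\<bar>"
        unfolding h_def by (intro le) linarith
      also have "\<dots> \<le> h x + l x"
        unfolding l_def by (intro add_left_mono abs_averaged_value_diff_le x u)
      finally show "k x (g x) + ennreal \<beta> * (\<integral>\<^sup>+x'. h x' \<partial>T x (g x)) \<le> h x + l x"
        unfolding q_eq[OF x u] .
    qed
    also have "\<dots> \<le> h x0 + ?R" by (intro add_left_mono loss_le g)
    finally show ?thesis .
  qed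

  show ?thesis
  \<comment> \<open>Only now is finiteness needed: the comparison returns to the reals, where the
    infimum over policies requires nonemptiness for one direction and the lower bound 0 on costs for
    the other.\<close>
  proof (cases "?R = \<infinity>")
    case False
    then obtain r where r: "0 \<le> r" "?R = ennreal r"
      by (cases ?R) auto
    have Jhat: "0 \<le> Jhat x0" by (rule approx_value_bounds[OF x0])
    have "Jhat x0 - r \<le> optimal_cost X U T c \<beta> x0"
      unfolding optimal_cost_def
    proof (rule cINF_greatest)
      show "admissible_policies X U \<noteq> {}" using stationary_policy_admissible[OF f] by blast
      fix \<gamma> assume \<gamma>: "\<gamma> \<in> admissible_policies X U"
      have "Jhat x0 \<le> discounted_cost X U T c \<beta> x0 \<gamma> + r"
        using upper[OF \<gamma>] cost_nonneg[OF \<gamma>] r(1) unfolding r(2) h_def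
        by (simp flip: ennreal_plus)
      then show "Jhat x0 - r \<le> discounted_cost X U T c \<beta> x0 \<gamma>" by simp
    qed
    moreover have "optimal_cost X U T c \<beta> x0 \<le> Jhat x0 + r"
    proof -
      note \<gamma> = stationary_policy_admissible[OF g]
      have "optimal_cost X U T c \<beta> x0 \<le> discounted_cost X U T c \<beta> x0 (stationary g)"
        unfolding optimal_cost_def by (intro cINF_lower bdd_belowI2[of _ 0] cost_nonneg \<gamma>)
      also have "\<dots> \<le> Jhat x0 + r"
        using lower r(1) Jhat unfolding r(2) h_def by (simp flip: ennreal_plus)
      finally show ?thesis .
    qed
    ultimately show ?thesis unfolding r(2) by (intro ennreal_leI) linarith
  qed simp
qed

end

section \<open>The bound in terms of the supremum norm\<close>

theorem theorem2p3:
  fixes X :: "(real ^ 'n) set" and U :: "'u::metric_space set"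
    and T :: "real ^ 'n \<Rightarrow> 'u \<Rightarrow> (real ^ 'n) measure"
    and c :: "real ^ 'n \<Rightarrow> 'u \<Rightarrow> real"
    and \<beta> \<alpha>\<^sub>c \<alpha>\<^sub>T :: real
    and B :: "nat \<Rightarrow> (real ^ 'n) set" and M :: nat
    and y :: "nat \<Rightarrow> real ^ 'n" and \<pi> :: "(real ^ 'n) measure"
    and x0 :: "real ^ 'n"
  assumes X_borel: "X \<in> sets borel"
    and kernel: "(\<lambda>(x, u). T x u) \<in> (borel_on X \<Otimes>\<^sub>M borel_on U) \<rightarrow>\<^sub>M prob_algebra (borel_on X)"
    and discount: "0 < \<beta>" "\<beta> < 1"
    and U: "U \<noteq> {}" "compact U" "finite U"
    and c_nonneg: "\<And>x u. x \<in> X \<Longrightarrow> u \<in> U \<Longrightarrow> 0 \<le> c x u"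
    and c_bounded: "bounded ((\<lambda>(x, u). c x u) ` (X \<times> U))"
    and c_continuous: "continuous_on (X \<times> U) (\<lambda>(x, u). c x u)"
    and feller: "weak_feller X U T"
    and constants: "0 < \<alpha>\<^sub>c" "0 < \<alpha>\<^sub>T"
    and c_lipschitz: "\<And>x x' u. x \<in> X \<Longrightarrow> x' \<in> X \<Longrightarrow> u \<in> U \<Longrightarrow>
      \<bar>c x u - c x' u\<bar> \<le> \<alpha>\<^sub>c * l1_norm (x - x')"
    and T_lipschitz: "\<And>x x' u. x \<in> X \<Longrightarrow> x' \<in> X \<Longrightarrow> u \<in> U \<Longrightarrow>
      tv_dist (T x u) (T x' u) \<le> \<alpha>\<^sub>T * l1_norm (x - x')"
    and bins: "\<And>i. i \<in> {1..M} \<Longrightarrow> B i \<in> sets (borel_on X)"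
      "disjoint_family_on B {1..M}" "(\<Union>i\<in>{1..M}. B i) = X"
    and representatives: "\<And>i. i \<in> {1..M} \<Longrightarrow> y i \<in> B i"
    and \<pi>: "prob_space \<pi>" "sets \<pi> = sets (borel_on X)"
      "\<And>i. i \<in> {1..M} \<Longrightarrow> 0 < measure \<pi> (B i)"
    and x0: "x0 \<in> X"
  shows "ennreal \<bar>approx_value U T c \<beta> B M y \<pi> x0 - optimal_cost X U T c \<beta> x0\<bar>
    \<le> ennreal ((\<alpha>\<^sub>c + \<beta> * \<alpha>\<^sub>T * cost_sup_norm X U c / (1 - \<beta>)) * (1 / (1 - \<beta>)))
      * (SUP \<gamma>\<in>stationary_policies X U.
          \<integral>\<^sup>+x. quantization_loss B M \<pi> x \<partial>occupation_measure X U T \<beta> x0 \<gamma>)"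
proof -
  \<comment> \<open>The norm is a supremum of reals, which dominates the costs only once the set is
    known to be bounded above.\<close>
  have c_bdd: "bdd_above ((\<lambda>(x, u). \<bar>c x u\<bar>) ` (X \<times> U))"
  proof -
    obtain b where "\<forall>p\<in>X \<times> U. \<bar>c (fst p) (snd p)\<bar> \<le> b"
      using c_bounded by (auto simp: bounded_iff)
    then show ?thesis by (intro bdd_aboveI2[of _ _ b]) auto
  qed
  have c_le: "\<bar>c x u\<bar> \<le> cost_sup_norm X U c" if "x \<in> X" "u \<in> U" for x u
    unfolding cost_sup_norm_def using cSUP_upper[OF _ c_bdd, of "(x, u)"] that by simp
  obtain v where "v \<in> U" using U by auto
  then have N: "0 \<le> cost_sup_norm X U c" using c_le[OF x0, of v] by linarith
  \<comment> \<open>Joint continuity on \<open>X \<times> U\<close> gives continuity of each section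
    on \<open>X\<close>, hence Borel measurability on the restricted space.\<close>
  have c_meas: "(\<lambda>x. c x u) \<in> borel_measurable (borel_on X)" if "u \<in> U" for u
  proof (rule borel_measurable_continuous_on_restrict)
    have "continuous_on X (\<lambda>x. (\<lambda>(x, u). c x u) (x, u))"
      by (rule continuous_on_compose2[OF c_continuous]) (use that in \<open>auto intro!: continuous_intros\<close>)
    then show "continuous_on X (\<lambda>x. c x u)" by simp
  qed
  have c_le': "c x u \<le> cost_sup_norm X U c" if "x \<in> X" "u \<in> U" for x u
    using c_le[OF that] by linarith
  have mdp: "finite_action_mdp X U T \<beta>"
    by (rule finite_action_mdp.intro) fact+
  interpret quantized_mdp X U T \<beta> c "cost_sup_norm X U c" \<alpha>\<^sub>c \<alpha>\<^sub>T B M y \<pi>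
    by (intro quantized_mdp.intro quantized_mdp_axioms.intro)
      (fact mdp c_meas N c_le' assms)+
  show ?thesis
    using approx_value_error[OF x0] by (simp only: lip_const_def)
qed

end
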